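(* Let $p>1$, $1<\alpha<p$, $T>0$, $\delta\in(0,1)$ and $\lambda:=(1-\delta)/(4T)$. There exists $\gamma_3=\gamma_3(N,p,\alpha,\delta)>0$ such that the following holds. Let $\mu_1$ be a Radon measure on $\mathbf{R}^N$ with $\operatorname{supp}\mu_1\subset D_T$ and $$\sup_{x\in D_T}\frac{1}{|B(x,T^{1/2})|}\int_{B(x,T^{1/2})}e^{-\lambda y_N^2}\,d\mu_1(y)\le\gamma_3T^{-\frac{1}{2(p-1)}},$$ and let $\mu_2$ be a nonnegative measurable function on $\mathbf{R}^N_+$ with $\operatorname{supp}\mu_2\subset D_T'$ and $$\sup_{x\in D_T'}\Big[\frac{1}{|B(x,\sigma)|}\int_{B(x,\sigma)}\mu_2(y)^\alpha\,dy\Big]^{1/\alpha}\le\gamma_3\sigma^{-\frac{1}{p-1}}\quad\text{for all }0<\sigma<T^{1/2}.$$ Then there exists a solution $u$ of the initial-boundary problem with initial data $\mu=\mu_1+\mu_2$ in $[0,T)$ such that $0\le u(x,t)\le2[S(t)\mu_1](x)+2\big([S(t)\mu_2^\alpha](x)\big)^{1/\alpha}$ for $(x,t)\in D\times(0,T)$.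
   Context: Let $N\ge1$. Write $x=(x',x_N)$, $\mathbf{R}^N_+=\{x_N>0\}$, $D:=\overline{\mathbf{R}^N_+}$, identifying $\partial\mathbf{R}^N_+$ with $\mathbf{R}^{N-1}$; $B(x,r)$ is the open ball, $|E|$ Lebesgue measure. For $L\ge0$, $D_L:=\{x:x_N\ge L^{1/2}\}$ and $D_L':=\{x:0\le x_N<L^{1/2}\}$. Let $\Gamma_N(x,t)=(4\pi t)^{-N/2}e^{-|x|^2/(4t)}$, $G(x,y,t):=\Gamma_N(x-y,t)+\Gamma_N(x-y_*,t)$, $y_*=(y',-y_N)$, and $[S(t)\mu](x):=\int_DG(x,y,t)\,d\mu(y)$ (a nonnegative locally integrable function $\phi$ is identified with the measure $\phi\,dx$; functions on $\mathbf{R}^N_+$ are extended by zero). A nonnegative continuous $u$ on $D\times(0,T)$ is a solution of the initial-boundary problem ($\partial_tu=\Delta u$ in $\mathbf{R}^N_+$, $\partial_\nu u=u^p$ on $\partial\mathbf{R}^N_+$, $u(\cdot,0)=\mu$) in $[0,T)$ if for all $(x,t)\in D\times(0,T)$, $u(x,t)=[S(t)\mu](x)+\int_0^t\int_{\mathbf{R}^{N-1}}G(x,(y',0),t-s)u(y',0,s)^p\,dy'\,ds.$ *)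

theory Defs
  imports "HOL-Analysis.Analysis"
begin

text \<open>Points of R^N are vectors real^'n with N = CARD('n); a distinguished index k plays
  the role of the last coordinate x_N.\<close>

definition halfspace_closed :: "'n::finite \<Rightarrow> (real^'n) set" where
  "halfspace_closed k = {x. x $ k \<ge> 0}"

definition D_L :: "'n::finite \<Rightarrow> real \<Rightarrow> (real^'n) set" where
  "D_L k L = {x. x $ k \<ge> sqrt L}"

definition D_L' :: "'n::finite \<Rightarrow> real \<Rightarrow> (real^'n) set" where
  "D_L' k L = {x. 0 \<le> x $ k \<and> x $ k < sqrt L}"

definition heat_kernel :: "(real^'n::finite) \<Rightarrow> real \<Rightarrow> real" where
  "heat_kernel z t = (4 * pi * t) powr (- real CARD('n) / 2) * exp (- (norm z)\<^sup>2 / (4 * t))"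

definition reflect :: "'n::finite \<Rightarrow> real^'n \<Rightarrow> real^'n" where
  "reflect k y = (\<chi> i. if i = k then - (y $ i) else y $ i)"

definition Gker :: "'n::finite \<Rightarrow> real^'n \<Rightarrow> real^'n \<Rightarrow> real \<Rightarrow> real" where
  "Gker k x y t = heat_kernel (x - y) t + heat_kernel (x - reflect k y) t"

definition Sop :: "'n::finite \<Rightarrow> real \<Rightarrow> (real^'n) measure \<Rightarrow> real^'n \<Rightarrow> ennreal" where
  "Sop k t M x = (\<integral>\<^sup>+ y. ennreal (Gker k x y t) * indicator (halfspace_closed k) y \<partial>M)"

definition fmeas :: "(real^'n::finite \<Rightarrow> real) \<Rightarrow> (real^'n) measure" where
  "fmeas \<phi> = density lebesgue (\<lambda>y. ennreal (\<phi> y))"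

text \<open>(N-1)-dimensional Lebesgue measure on the boundary {x_N = 0}, identified with R^{N-1}.\<close>
definition bdry_measure :: "'n::finite \<Rightarrow> (real^'n) measure" where
  "bdry_measure k = distr (PiM (UNIV - {k}) (\<lambda>_. lborel)) borel
      (\<lambda>f. \<chi> i. if i = k then 0 else f i)"

text \<open>Solution of the initial-boundary problem in [0,T) with initial data mu1 + mu2,
  given via its heat semigroup term S0 t x = [S(t)(mu1+mu2)](x).\<close>
definition is_solution ::
  "'n::finite \<Rightarrow> real \<Rightarrow> real \<Rightarrow> (real \<Rightarrow> real^'n \<Rightarrow> ennreal) \<Rightarrow> (real^'n \<Rightarrow> real \<Rightarrow> real) \<Rightarrow> bool" where
  "is_solution k p T S0 u \<longleftrightarrow>
     continuous_on (halfspace_closed k \<times> {0<..<T}) (\<lambda>(x, t). u x t) \<and>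
     (\<forall>x\<in>halfspace_closed k. \<forall>t\<in>{0<..<T}. u x t \<ge> 0) \<and>
     (\<forall>x\<in>halfspace_closed k. \<forall>t\<in>{0<..<T}.
        ennreal (u x t) = S0 t x +
          (\<integral>\<^sup>+ s. indicator {0<..<t} s *
              (\<integral>\<^sup>+ y. ennreal (Gker k x y (t - s) * (u y s) powr p) \<partial>bdry_measure k) \<partial>lborel))"

definition enn_root :: "real \<Rightarrow> ennreal \<Rightarrow> ennreal" where
  "enn_root a z = (if z = \<infinity> then \<infinity> else ennreal (enn2real z powr (1 / a)))"

end

theory Submission
  imports Defs "HOL-Probability.Distributions"
begin

text \<open>
  Write \<open>a = S(t)\<mu>\<^sub>1\<close>, \<open>J = S(t)\<mu>\<^sub>2\<^sup>\<alpha>\<close>, \<open>v = J powr (1/\<alpha>)\<close> and \<open>q = 1 / (2(p-1))\<close>.  The function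
  \<open>w = 2a + 2v\<close> is a supersolution when \<open>\<gamma>\<^sub>3\<close> is small, and monotone iteration below \<open>w\<close> yields the
  solution.  The hypothesis on \<open>\<mu>\<^sub>1\<close> gives \<open>a \<le> C \<gamma>\<^sub>3 T powr (-q)\<close> on the boundary, because there the kernel
  beats the weight by a Gaussian factor on \<open>x\<^sub>N \<ge> sqrt T\<close>; the hypothesis on \<open>\<mu>\<^sub>2\<close>, used with
  \<open>\<sigma> = sqrt t\<close>, gives \<open>v \<le> C \<gamma>\<^sub>3 t powr (-q)\<close> everywhere.  Hence on the boundary \<open>w powr p\<close> is at most
  \<open>C \<gamma>\<^sub>3 powr (p-1) T powr (-1/2) a + C \<gamma>\<^sub>3 powr (p-\<alpha>) t powr (-\<beta>) J\<close> with \<open>\<beta> = (p-\<alpha>) / (2(p-1)) < 1/2\<close>,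
  which is linear in the two heat flows.  The Chapman-Kolmogorov identity on the boundary hyperplane
  and a Beta integral in time show that the Duhamel operator maps \<open>t powr (-\<beta>) S(t)\<nu>\<close> below
  \<open>C t powr (1/2-\<beta>) S(t)\<nu>\<close>; the bound on \<open>v\<close> then turns \<open>J\<close> back into \<open>v\<close>.
\<close>

section \<open>The heat kernel and its reflection\<close>

text \<open>A boundary source gains only half an order in time. Integrating the kernel over the
  hyperplane leaves its normal factor, so the Duhamel kernel carries
  \<open>(t - s) powr (-1/2)\<close>, and comparing the composition of two flows across the
  hyperplane with one flow costs a further \<open>s powr (-1/2)\<close>. A weight
  \<open>s powr (-\<beta>)\<close> on the source therefore stays integrable at \<open>s = 0\<close>
  only for \<beta> < 1/2, which for the \<beta> above says exactly \<alpha> > 1: this is why the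
  second datum is measured by averages of its power \<alpha> and not of the function itself. The
  condition \<alpha> < p leaves a positive power \<open>p - \<alpha>\<close> of \<open>v\<close> to
  spend on its decay. The two bounds have different ranges. The one on \<open>a\<close> holds on the
  boundary only, which is where the source is evaluated; in the interior finiteness is enough, and
  it follows by comparison with the origin at a later time. The one on \<open>v\<close> is needed at
  every point, because \<open>J\<close> is turned back into \<open>v\<close> at the target point of
  the Duhamel integral.\<close>

abbreviation heat1 :: "real \<Rightarrow> real \<Rightarrow> real" where
  "heat1 t \<equiv> normal_density 0 (sqrt (2 * t))"

text \<open>The kernel in one dimension is the centred normal density of variance
  \<open>2 * t\<close>; this makes the convolution formula for normal densities serve as the
  Chapman-Kolmogorov identity.\<close>

lemma heat1_eq: "t > 0 \<Longrightarrow> heat1 t a = exp (- a\<^sup>2 / (4 * t)) / sqrt (4 * pi * t)"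
  by (simp add: normal_density_def mult.commute)

lemma heat_kernel_eq_prod:
  fixes z :: "real^'n"
  assumes "t > 0"
  shows "heat_kernel z t = (\<Prod>i\<in>UNIV. heat1 t (z $ i))"
proof -
  have 1: "(norm z)\<^sup>2 = (\<Sum>i\<in>UNIV. (z $ i)\<^sup>2)"
    unfolding power2_norm_eq_inner inner_vec_def by (simp only: inner_real_def power2_eq_square)
  have "(4 * pi * t) powr (- real CARD('n) / 2) = ((4 * pi * t) powr (- 1 / 2)) powr (real CARD('n))"
    by (simp add: powr_powr)
  also have "\<dots> = ((4 * pi * t) powr (- 1 / 2)) ^ CARD('n)"
    using assms by (simp add: powr_realpow)
  also have "(4 * pi * t) powr (- 1 / 2) = 1 / sqrt (4 * pi * t)"
    using assms powr_half_sqrt[of "4 * pi * t"] powr_minus_divide[of "4 * pi * t" "1 / 2"]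
    by (simp del: powr_half_sqrt)
  finally have 2: "(4 * pi * t) powr (- real CARD('n) / 2) = (1 / sqrt (4 * pi * t)) ^ CARD('n)" .
  have 3: "exp (- (norm z)\<^sup>2 / (4 * t)) = (\<Prod>i\<in>UNIV. exp (- (z $ i)\<^sup>2 / (4 * t)))"
    unfolding 1 by (simp add: exp_sum[symmetric] sum_negf sum_divide_distrib)
  show ?thesis
    unfolding heat_kernel_def 2 3 using assms
    by (simp add: heat1_eq prod_dividef power_one_over)
qed

lemma heat_kernel_nonneg [simp]: "heat_kernel z t \<ge> 0"
  by (simp add: heat_kernel_def)

lemma heat_kernel_pos: "t > 0 \<Longrightarrow> heat_kernel z t > 0"
  by (simp add: heat_kernel_def)

lemma Gker_nonneg [simp]: "Gker k x y t \<ge> 0"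
  by (simp add: Gker_def)

lemma measurable_heat_kernel [measurable (raw)]:
  assumes [measurable]: "f \<in> borel_measurable M" "g \<in> borel_measurable M"
  shows "(\<lambda>w. heat_kernel (f w) (g w)) \<in> borel_measurable M"
  unfolding heat_kernel_def by measurable

lemma borel_measurable_vec_components:
  fixes f :: "'a \<Rightarrow> real^'n"
  assumes "\<And>i. (\<lambda>w. f w $ i) \<in> borel_measurable M"
  shows "f \<in> borel_measurable M"
  unfolding borel_measurable_euclidean_space[of f]
  using assms by (auto simp: Basis_vec_def inner_axis)

lemma measurable_reflect [measurable]: "reflect k \<in> borel_measurable borel"
proof (rule borel_measurable_vec_components)
  fix i
  show "(\<lambda>w. reflect k w $ i) \<in> borel_measurable borel"
    by (cases "i = k") (simp_all add: reflect_def)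
qed

lemma measurable_Gker [measurable (raw)]:
  assumes [measurable]: "f \<in> borel_measurable M" "g \<in> borel_measurable M" "h \<in> borel_measurable M"
  shows "(\<lambda>w. Gker k (f w) (g w) (h w)) \<in> borel_measurable M"
  unfolding Gker_def by measurable

lemma halfspace_closed_measurable [measurable]: "halfspace_closed k \<in> sets borel"
  unfolding halfspace_closed_def by measurable

lemma norm_reflect [simp]: "norm (reflect k y) = norm y"
proof -
  have "(reflect k y) \<bullet> (reflect k y) = y \<bullet> y"
    unfolding inner_vec_def reflect_def by (intro sum.cong) auto
  then show ?thesis by (simp add: norm_eq_sqrt_inner)
qed

lemma reflect_reflect [simp]: "reflect k (reflect k y) = y"
  by (simp add: reflect_def vec_eq_iff)

lemma reflect_diff: "reflect k (x - y) = reflect k x - reflect k y"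
  by (simp add: reflect_def vec_eq_iff)

lemma reflect_boundary: "y $ k = 0 \<Longrightarrow> reflect k y = y"
  by (simp add: reflect_def vec_eq_iff)

lemma heat_kernel_reflect: "heat_kernel (x - reflect k y) t = heat_kernel (reflect k x - y) t"
proof -
  have "norm (x - reflect k y) = norm (reflect k (x - reflect k y))" by simp
  also have "\<dots> = norm (reflect k x - y)" by (simp add: reflect_diff)
  finally show ?thesis by (simp add: heat_kernel_def)
qed

lemma heat_kernel_le_Gker: "heat_kernel (x - y) t \<le> Gker k x y t"
  by (simp add: Gker_def)

lemma Gker_boundary_left: "x $ k = 0 \<Longrightarrow> Gker k x y t = 2 * heat_kernel (x - y) t"
  by (simp add: Gker_def heat_kernel_reflect reflect_boundary)

lemma Gker_boundary_right: "y $ k = 0 \<Longrightarrow> Gker k x y t = 2 * heat_kernel (x - y) t"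
  by (simp add: Gker_def reflect_boundary)

lemma nn_integral_heat1: "t > 0 \<Longrightarrow> (\<integral>\<^sup>+ y. ennreal (heat1 t (a - y)) \<partial>lborel) = 1"
proof -
  assume t: "t > 0"
  have "heat1 t (a - y) = normal_density a (sqrt (2 * t)) y" for y
    by (simp add: normal_density_def power2_commute)
  then show ?thesis using t
    by (simp add: nn_integral_eq_integral integrable_normal_density)
qed

lemma nn_integral_heat_kernel:
  fixes x :: "real^'n"
  assumes t: "t > 0"
  shows "(\<integral>\<^sup>+ y. ennreal (heat_kernel (x - y) t) \<partial>lborel) = 1"
proof -
  have B: "(\<Prod>b\<in>Basis. f b) = (\<Prod>i\<in>UNIV. f (axis i (1::real)))" for f :: "real^'n \<Rightarrow> ennreal"
  proof (rule prod.reindex_cong[where l = "\<lambda>i. axis i 1"])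
    show "inj_on (\<lambda>i. axis i (1::real) :: real^'n) UNIV" by (rule inj_onI) (simp add: axis_eq_axis)
    show "(Basis :: (real^'n) set) = range (\<lambda>i. axis i 1)" by (auto simp: Basis_vec_def)
  qed simp
  have "(\<integral>\<^sup>+ y. ennreal (heat_kernel (x - y) t) \<partial>lborel)
      = (\<integral>\<^sup>+ y. (\<Prod>b\<in>Basis. ennreal (heat1 t (x \<bullet> b - y \<bullet> b))) \<partial>lborel)"
    by (simp add: heat_kernel_eq_prod[OF t] prod_ennreal B inner_axis)
  also have "\<dots> = (\<Prod>b\<in>(Basis::(real^'n) set). (\<integral>\<^sup>+ y. ennreal (heat1 t (x \<bullet> b - y)) \<partial>lborel))"
    by (rule nn_integral_lborel_prod) auto
  also have "\<dots> = 1" by (simp add: nn_integral_heat1[OF t])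
  finally show ?thesis .
qed

lemma heat1_convolution:
  assumes "s > 0" "t > 0"
  shows "(\<integral>\<^sup>+ y. ennreal (heat1 s (a - y) * heat1 t (y - b)) \<partial>lborel) = ennreal (heat1 (s + t) (a - b))"
proof -
  have "(\<integral>\<^sup>+ y. ennreal (heat1 s (a - y) * heat1 t (y - b)) \<partial>lborel)
     = (\<integral>\<^sup>+ y. ennreal (heat1 s ((a - b) - y) * heat1 t y) \<partial>lborel)"
    by (subst nn_integral_real_affine[where c = 1 and t = b]) (measurable, simp_all add: diff_diff_eq)
  also have "\<dots> = ennreal (normal_density 0 (sqrt ((sqrt (2 * s))\<^sup>2 + (sqrt (2 * t))\<^sup>2)) (a - b))"
    by (rule fun_cong[OF conv_normal_density_zero_mean]) (use assms in simp_all)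
  also have "\<dots> = ennreal (heat1 (s + t) (a - b))" using assms by (simp add: distrib_left)
  finally show ?thesis .
qed

section \<open>Gaussian integrals over the boundary hyperplane\<close>

lemma measurable_bdry_embedding [measurable]:
  "(\<lambda>f. \<chi> i. if i = k then 0 else f i) \<in> borel_measurable (PiM (UNIV - {k}) (\<lambda>_. lborel :: real measure))"
proof (rule borel_measurable_vec_components)
  fix i
  show "(\<lambda>w. (\<chi> i. if i = k then 0 else w i) $ i) \<in> borel_measurable (PiM (UNIV - {k}) (\<lambda>_. lborel :: real measure))"
    by (cases "i = k") (simp_all)
qed

lemma sets_bdry_measure [measurable_cong, simp]: "sets (bdry_measure k) = sets borel"
  by (simp add: bdry_measure_def)

lemma space_bdry_measure [simp]: "space (bdry_measure k) = UNIV"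
  by (simp add: bdry_measure_def)

lemma nn_integral_bdry_measure:
  assumes [measurable]: "f \<in> borel_measurable borel"
  shows "(\<integral>\<^sup>+ y. f y \<partial>bdry_measure k)
    = (\<integral>\<^sup>+ g. f (\<chi> i. if i = k then 0 else g i) \<partial>PiM (UNIV - {k}) (\<lambda>_. lborel))"
  unfolding bdry_measure_def by (rule nn_integral_distr) auto

lemma AE_bdry_measure: "AE y in bdry_measure k. y $ k = 0"
  unfolding bdry_measure_def by (subst AE_distr_iff) auto

interpretation bdry: product_sigma_finite "\<lambda>_. lborel :: real measure" ..

lemma prod_univ_remove: "(\<Prod>i\<in>UNIV. f i) = f k * (\<Prod>i\<in>UNIV - {k}. f i)" for f :: "'n::finite \<Rightarrow> 'b::comm_monoid_mult"
  by (rule prod.remove) auto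

text \<open>The tangential factors integrate to one, while the factor in direction \<open>k\<close>
  is not integrated at all. What remains is of size \<open>t powr (-1/2)\<close> at boundary points,
  the source of the time singularity in the Duhamel term.\<close>

lemma nn_integral_bdry_heat_kernel:
  assumes t: "t > 0"
  shows "(\<integral>\<^sup>+ y. ennreal (heat_kernel (x - y) t) \<partial>bdry_measure k) = ennreal (heat1 t (x $ k))"
proof -
  have "(\<integral>\<^sup>+ y. ennreal (heat_kernel (x - y) t) \<partial>bdry_measure k)
     = (\<integral>\<^sup>+ g. ennreal (heat1 t (x $ k)) * (\<Prod>i\<in>UNIV - {k}. ennreal (heat1 t (x $ i - g i)))
           \<partial>PiM (UNIV - {k}) (\<lambda>_. lborel))"
    by (subst nn_integral_bdry_measure)
       (auto simp: heat_kernel_eq_prod[OF t] prod_univ_remove[of _ k] ennreal_mult prod_ennreal prod_nonneg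
          intro!: nn_integral_cong)
  also have "\<dots> = ennreal (heat1 t (x $ k)) * (\<Prod>i\<in>UNIV - {k}. \<integral>\<^sup>+ y. ennreal (heat1 t (x $ i - y)) \<partial>lborel)"
    by (subst nn_integral_cmult, measurable, subst bdry.product_nn_integral_prod) auto
  also have "\<dots> = ennreal (heat1 t (x $ k))" by (simp add: nn_integral_heat1[OF t])
  finally show ?thesis .
qed

text \<open>Chapman-Kolmogorov acts in the tangential coordinates only; in direction
  \<open>k\<close> the intermediate point is pinned to 0, so the two normal factors survive as a
  plain product.\<close>

lemma nn_integral_bdry_heat_kernel_mult:
  fixes x z :: "real^'n"
  assumes s: "s > 0" and t: "t > 0"
  shows "(\<integral>\<^sup>+ y. ennreal (heat_kernel (x - y) s * heat_kernel (y - z) t) \<partial>bdry_measure k)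
     = ennreal (heat1 s (x $ k) * heat1 t (z $ k)
          * (\<Prod>i\<in>UNIV - {k}. heat1 (s + t) (x $ i - z $ i)))"
proof -
  have m: "heat1 t (0 - a) = heat1 t a" for t a by (simp add: normal_density_def)
  have "(\<integral>\<^sup>+ y. ennreal (heat_kernel (x - y) s * heat_kernel (y - z) t) \<partial>bdry_measure k)
     = (\<integral>\<^sup>+ g. ennreal (heat1 s (x $ k) * heat1 t (z $ k))
          * (\<Prod>i\<in>UNIV - {k}. ennreal (heat1 s (x $ i - g i) * heat1 t (g i - z $ i)))
           \<partial>PiM (UNIV - {k}) (\<lambda>_. lborel))"
  proof (subst nn_integral_bdry_measure, measurable, intro nn_integral_cong)
    fix g :: "'n \<Rightarrow> real"
    have "heat_kernel (x - (\<chi> i. if i = k then 0 else g i)) s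
        = heat1 s (x $ k) * (\<Prod>i\<in>UNIV - {k}. heat1 s (x $ i - g i))"
      by (simp add: heat_kernel_eq_prod[OF s] prod_univ_remove[of _ k])
    moreover have "heat_kernel ((\<chi> i. if i = k then 0 else g i) - z) t
        = heat1 t (z $ k) * (\<Prod>i\<in>UNIV - {k}. heat1 t (g i - z $ i))"
      using m[of t "z $ k"] by (simp add: heat_kernel_eq_prod[OF t] prod_univ_remove[of _ k])
    ultimately show "ennreal (heat_kernel (x - (\<chi> i. if i = k then 0 else g i)) s
          * heat_kernel ((\<chi> i. if i = k then 0 else g i) - z) t)
        = ennreal (heat1 s (x $ k) * heat1 t (z $ k))
          * (\<Prod>i\<in>UNIV - {k}. ennreal (heat1 s (x $ i - g i) * heat1 t (g i - z $ i)))"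
      by (simp only: prod_ennreal[OF mult_nonneg_nonneg[OF normal_density_nonneg normal_density_nonneg]]
         prod.distrib ennreal_mult[symmetric] mult_nonneg_nonneg normal_density_nonneg prod_nonneg mult_ac)
  qed
  also have "\<dots> = ennreal (heat1 s (x $ k) * heat1 t (z $ k))
     * (\<Prod>i\<in>UNIV - {k}. \<integral>\<^sup>+ y. ennreal (heat1 s (x $ i - y) * heat1 t (y - z $ i)) \<partial>lborel)"
    by (subst nn_integral_cmult, measurable, subst bdry.product_nn_integral_prod) auto
  also have "\<dots> = ennreal (heat1 s (x $ k) * heat1 t (z $ k)
          * (\<Prod>i\<in>UNIV - {k}. heat1 (s + t) (x $ i - z $ i)))"
    by (simp only: heat1_convolution[OF s t] prod_ennreal[OF normal_density_nonneg]
         ennreal_mult[symmetric] mult_nonneg_nonneg normal_density_nonneg prod_nonneg)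
  finally show ?thesis .
qed

section \<open>The heat flow of a weighted measure\<close>

text \<open>By Markov's inequality the sets where \<open>h\<close> is at least \<open>1/n\<close>
  have finite measure, and positivity of \<open>h\<close> makes them exhaust the space. For the
  boundary measure the heat kernel at time one serves as \<open>h\<close>.\<close>

lemma sigma_finite_measure_if_integrable:
  assumes h[measurable]: "h \<in> borel_measurable M"
    and pos: "\<And>x. x \<in> space M \<Longrightarrow> h x > 0"
    and fin: "(\<integral>\<^sup>+ x. h x \<partial>M) < \<infinity>"
  shows "sigma_finite_measure M"
proof
  define A where "A n = {x \<in> space M. 1 \<le> of_nat n * h x}" for n :: nat
  have [measurable]: "A n \<in> sets M" for n
    unfolding A_def by measurable
  have "emeasure M (A n) \<noteq> \<infinity>" for n
  proof -
    have "emeasure M (A n) \<le> of_nat n * (\<integral>\<^sup>+ x. h x * indicator (space M) x \<partial>M)"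
      unfolding A_def by (rule nn_integral_Markov_inequality) auto
    also have "\<dots> = of_nat n * (\<integral>\<^sup>+ x. h x \<partial>M)"
      by (intro arg_cong2[where f = "(*)"] nn_integral_cong) (auto simp: indicator_def)
    also have "\<dots> < \<infinity>" using fin by (simp add: ennreal_mult_less_top of_nat_less_top)
    finally show ?thesis by simp
  qed
  moreover have "x \<in> (\<Union>n. A n)" if x: "x \<in> space M" for x
  proof (cases "h x = \<infinity>")
    case True
    then show ?thesis using x unfolding A_def
      by (auto intro!: exI[of _ 1])
  next
    case False
    then obtain r where r: "h x = ennreal r" "r > 0"
      using pos[OF x] by (cases "h x") auto
    obtain n where "1 / r < real n" using reals_Archimedean2 by blast
    then have "1 \<le> real n * r" using r by (simp add: field_simps)
    then have "1 \<le> of_nat n * h x"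
      using r by (simp add: ennreal_of_nat_eq_real_of_nat ennreal_mult[symmetric])
    then show ?thesis using x unfolding A_def by auto
  qed
  ultimately show "\<exists>A. countable A \<and> A \<subseteq> sets M \<and> \<Union>A = space M \<and> (\<forall>a\<in>A. emeasure M a \<noteq> \<infinity>)"
    by (intro exI[of _ "range A"]) (auto simp: A_def)
qed

lemma sigma_finite_bdry_measure: "sigma_finite_measure (bdry_measure k)"
proof (rule sigma_finite_measure_if_integrable)
  show "(\<integral>\<^sup>+ y. ennreal (heat_kernel (0 - y) 1) \<partial>bdry_measure k) < \<infinity>"
    by (simp only: nn_integral_bdry_heat_kernel[of 1]) simp
qed (auto simp: heat_kernel_pos)

lemma ennreal_le_if_divide_le:
  assumes "b > 0" "X / ennreal b \<le> A"
  shows "X \<le> A * ennreal b"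
proof -
  have "X = X / ennreal b * ennreal b"
    using assms(1) by (simp add: ennreal_divide_times ennreal_divide_self)
  also have "\<dots> \<le> A * ennreal b" using assms(2) by (rule mult_right_mono) simp
  finally show ?thesis .
qed

interpretation bdry_sf: sigma_finite_measure "bdry_measure k" for k :: "'n::finite"
  by (rule sigma_finite_bdry_measure)

interpretation lborel_bdry: pair_sigma_finite lborel "bdry_measure k" for k :: "'n::finite" ..

text \<open>One measure with a density covers every flow that occurs: the first datum with density
  1, Lebesgue measure with density \<open>g\<close>, its power \<alpha> or 1, and the first datum
  with its exponential weight. Sigma-finiteness is there for Fubini.\<close>

locale weighted_measure = sigma_finite_measure M
  for M :: "(real^'n) measure" and h :: "real^'n \<Rightarrow> ennreal" +
  assumes sets_M [measurable_cong, simp]: "sets M = sets borel"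
    and h_measurable [measurable]: "h \<in> borel_measurable borel"
begin

lemma space_M [simp]: "space M = UNIV"
  using sets_eq_imp_space_eq[OF sets_M] by simp

definition flow :: "'n \<Rightarrow> real \<Rightarrow> real^'n \<Rightarrow> ennreal" where
  "flow k t x = (\<integral>\<^sup>+ y. ennreal (Gker k x y t) * indicator (halfspace_closed k) y * h y \<partial>M)"

lemma measurable_flow [measurable (raw)]:
  assumes [measurable]: "f \<in> borel_measurable N" "g \<in> borel_measurable N"
  shows "(\<lambda>w. flow k (f w) (g w)) \<in> borel_measurable N"
  unfolding flow_def by measurable

lemma nn_integral_heat_kernel_le_average:
  fixes r t :: real
  assumes r: "r > 0" and t: "t > 0"
    and S: "AE y in M. h y \<noteq> 0 \<longrightarrow> y \<in> S"
    and A: "\<And>x. x \<in> S \<Longrightarrow>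
      (\<integral>\<^sup>+ y. h y * indicator (ball x r) y \<partial>M) / emeasure lebesgue (ball x r) \<le> A"
  shows "(\<integral>\<^sup>+ y. ennreal (heat_kernel (x - y) t) * h y \<partial>M)
    \<le> ennreal (exp (r\<^sup>2 / (16 * t)) * 2 powr (3 * real CARD('n) / 2)) * A"
proof -
  \<comment> \<open>Spread each point \<open>y\<close> uniformly over the ball of radius \<open>r/2\<close> around it and exchange the integrals:
    this replaces a covering argument.\<close>
  interpret P: pair_sigma_finite M "lborel :: (real^'n) measure" ..
  let ?N = "real CARD('n)"
  \<comment> \<open>\<open>2 powr (N/2)\<close> comes from doubling the time in the normalisation;
    the volume ratio \<open>2 ^ N\<close> of the balls of radius \<open>r\<close> and
    \<open>r/2\<close> later completes it to \<open>2 powr (3 * N / 2)\<close>.\<close>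
  define c where "c = exp (r\<^sup>2 / (16 * t)) * 2 powr (?N / 2)"
  define b where "b = unit_ball_vol ?N * (r / 2) ^ CARD('n)"
  have c0: "c > 0" by (simp add: c_def)
  have b0: "b > 0" using r by (simp add: b_def)
  have ball_half: "emeasure lborel (ball y (r / 2)) = ennreal b" for y :: "real^'n"
    using r by (simp add: emeasure_ball b_def)
  have ball_full: "emeasure lebesgue (ball y r) = ennreal (2 ^ CARD('n) * b)" for y :: "real^'n"
    using r by (simp add: emeasure_ball b_def power_divide)
  \<comment> \<open>Moving the centre from \<open>y\<close> to \<open>z\<close> is paid for by
    doubling the time: \<open>|x-z|^2 <= 2 |x-y|^2 + r^2/2\<close>, divided by
    \<open>8 * t\<close>.\<close>
  have pw: "heat_kernel (x - y) t \<le> c * heat_kernel (x - z) (2 * t)" if "z \<in> ball y (r / 2)" for y z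
  proof -
    have "norm (x - z) \<le> norm (x - y) + norm (y - z)"
      using norm_triangle_ineq[of "x - y" "y - z"] by simp
    also have "\<dots> \<le> norm (x - y) + r / 2" using that by (simp add: dist_norm)
    finally have "(norm (x - z))\<^sup>2 \<le> (norm (x - y) + r / 2)\<^sup>2"
      by (rule power_mono) simp
    also have "\<dots> \<le> 2 * (norm (x - y))\<^sup>2 + r\<^sup>2 / 2"
      using sum_squares_bound[of "norm (x - y)" "r / 2"] by (simp add: power2_sum power_divide)
    finally have "(norm (x - z))\<^sup>2 / (8 * t) \<le> (norm (x - y))\<^sup>2 / (4 * t) + r\<^sup>2 / (16 * t)"
      using t by (simp add: field_simps)
    then have e: "exp (- (norm (x - y))\<^sup>2 / (4 * t))
        \<le> exp (r\<^sup>2 / (16 * t)) * exp (- (norm (x - z))\<^sup>2 / (8 * t))"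
      by (simp add: exp_add[symmetric])
    have "(4 * pi * t) powr (- ?N / 2) = 2 powr (?N / 2) * (4 * pi * (2 * t)) powr (- ?N / 2)"
    proof -
      have "(4 * pi * (2 * t)) powr (- ?N / 2) = (2 * (4 * pi * t)) powr (- ?N / 2)"
        by (simp add: mult_ac)
      also have "\<dots> = 2 powr (- ?N / 2) * (4 * pi * t) powr (- ?N / 2)"
        by (rule powr_mult)
      finally show ?thesis by (simp add: powr_add[symmetric] mult.assoc[symmetric])
    qed
    then show ?thesis
      unfolding heat_kernel_def c_def using mult_left_mono[OF e, of "(4 * pi * t) powr (- ?N / 2)"]
      by (simp add: mult_ac)
  qed
  \<comment> \<open>Averages are controlled only at centres in \<open>S\<close>. If \<open>S\<close>
    meets the half ball around \<open>z\<close>, that half ball lies in a full ball centred in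
    \<open>S\<close>; otherwise it carries no mass.\<close>
  have inner: "(\<integral>\<^sup>+ y. h y * indicator (ball y (r / 2)) z \<partial>M) \<le> A * ennreal (2 ^ CARD('n) * b)" for z
  proof (cases "\<exists>x'\<in>S. x' \<in> ball z (r / 2)")
    case True
    then obtain x' where x': "x' \<in> S" "dist z x' < r / 2" by auto
    have "(\<integral>\<^sup>+ y. h y * indicator (ball y (r / 2)) z \<partial>M) \<le> (\<integral>\<^sup>+ y. h y * indicator (ball x' r) y \<partial>M)"
    proof (intro nn_integral_mono mult_left_mono)
      fix y
      have "dist x' y < r" if "dist y z < r / 2"
        using dist_triangle2[of x' y z] that x' by (simp add: dist_commute)
      then show "indicator (ball y (r / 2)) z \<le> (indicator (ball x' r) y :: ennreal)"
        by (auto simp: indicator_def)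
    qed auto
    also have "\<dots> \<le> A * ennreal (2 ^ CARD('n) * b)"
      using A[OF x'(1)] b0 unfolding ball_full by (intro ennreal_le_if_divide_le) auto
    finally show ?thesis .
  next
    case False
    have "AE y in M. h y * indicator (ball y (r / 2)) z = 0"
      using S by eventually_elim (use False in \<open>auto simp: indicator_def dist_commute\<close>)
    then have "(\<integral>\<^sup>+ y. h y * indicator (ball y (r / 2)) z \<partial>M) = (\<integral>\<^sup>+ y. 0 \<partial>M)"
      by (rule nn_integral_cong_AE)
    then show ?thesis by simp
  qed
  have [measurable]: "(\<lambda>w. indicator (ball (fst w) (r / 2)) (snd w) :: ennreal)
      \<in> borel_measurable (M \<Otimes>\<^sub>M lborel)"
  proof -
    have eq: "(\<lambda>w. indicator (ball (fst w) (r / 2)) (snd w) :: ennreal)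
      = indicator {w \<in> space (M \<Otimes>\<^sub>M (lborel :: (real^'n) measure)). dist (fst w) (snd w) < r / 2}"
      by (auto simp: indicator_def fun_eq_iff space_pair_measure)
    show ?thesis unfolding eq by measurable
  qed
  have [measurable]: "(\<lambda>y. indicator (ball y (r / 2)) z :: ennreal) \<in> borel_measurable M" for z
  proof -
    have "(\<lambda>y. indicator (ball y (r / 2)) z :: ennreal) = indicator (ball z (r / 2))"
      by (auto simp: indicator_def fun_eq_iff dist_commute)
    also have "\<dots> \<in> borel_measurable M" by (intro borel_measurable_indicator) (simp add: borel_open)
    finally show ?thesis .
  qed
  have "ennreal b * (\<integral>\<^sup>+ y. ennreal (heat_kernel (x - y) t) * h y \<partial>M)
      = (\<integral>\<^sup>+ y. (\<integral>\<^sup>+ z. ennreal (heat_kernel (x - y) t) * h y * indicator (ball y (r / 2)) z \<partial>lborel) \<partial>M)"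
    by (subst nn_integral_cmult[symmetric], measurable)
       (simp add: nn_integral_cmult_indicator ball_half mult.commute)
  also have "\<dots> \<le> (\<integral>\<^sup>+ y. (\<integral>\<^sup>+ z. ennreal (c * heat_kernel (x - z) (2 * t))
        * (h y * indicator (ball y (r / 2)) z) \<partial>lborel) \<partial>M)"
    by (intro nn_integral_mono) (auto simp: indicator_def intro!: mult_right_mono ennreal_leI pw)
  also have "\<dots> = (\<integral>\<^sup>+ z. (\<integral>\<^sup>+ y. ennreal (c * heat_kernel (x - z) (2 * t))
        * (h y * indicator (ball y (r / 2)) z) \<partial>M) \<partial>lborel)"
    by (rule P.Fubini'[symmetric]) (simp add: split_beta', measurable)
  also have "\<dots> = (\<integral>\<^sup>+ z. ennreal (c * heat_kernel (x - z) (2 * t))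
        * (\<integral>\<^sup>+ y. h y * indicator (ball y (r / 2)) z \<partial>M) \<partial>lborel)"
    by (intro nn_integral_cong nn_integral_cmult) measurable
  also have "\<dots> \<le> (\<integral>\<^sup>+ z. ennreal (c * heat_kernel (x - z) (2 * t)) * (A * ennreal (2 ^ CARD('n) * b)) \<partial>lborel)"
    by (intro nn_integral_mono mult_left_mono inner) auto
  also have "\<dots> = ennreal b * (ennreal (c * 2 ^ CARD('n)) * A)"
    using c0 b0 t
    by (simp add: nn_integral_multc nn_integral_cmult ennreal_mult nn_integral_heat_kernel mult_ac)
  finally have "(\<integral>\<^sup>+ y. ennreal (heat_kernel (x - y) t) * h y \<partial>M) \<le> ennreal (c * 2 ^ CARD('n)) * A"
    using b0 by (subst (asm) ennreal_mult_le_mult_iff) auto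
  also have "c * 2 ^ CARD('n) = exp (r\<^sup>2 / (16 * t)) * 2 powr (3 * ?N / 2)"
  proof -
    have "2 powr (3 * ?N / 2) = 2 powr (?N / 2 + ?N)" by (simp add: field_simps)
    also have "\<dots> = 2 powr (?N / 2) * 2 ^ CARD('n)" by (subst powr_add) (simp add: powr_realpow)
    finally show ?thesis by (simp add: c_def)
  qed
  finally show ?thesis .
qed

end

section \<open>The boundary Duhamel operator\<close>

text \<open>The Cauchy-Schwarz inequality with weights \<open>s\<close> and \<open>t\<close>, proved
  by exhibiting the difference as a square. It governs every comparison of Gaussians at different
  times below.\<close>

lemma square_add_divide_le:
  fixes a b s t :: real
  assumes "s > 0" "t > 0"
  shows "(a + b)\<^sup>2 / (s + t) \<le> a\<^sup>2 / s + b\<^sup>2 / t"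
proof -
  have "a\<^sup>2 / s + b\<^sup>2 / t - (a + b)\<^sup>2 / (s + t) = (t * a - s * b)\<^sup>2 / (s * t * (s + t))"
    using assms by (simp add: divide_simps) (simp add: power2_eq_square algebra_simps)
  also have "\<dots> \<ge> 0" using assms by simp
  finally show ?thesis by simp
qed

text \<open>The exponents compare by Cauchy-Schwarz, so only the normalisations differ; their ratio
  is the stated factor divided by \<open>sqrt (4 * pi) >= 1\<close>. This pointwise bound stands in
  for the normal integration that the hyperplane does not provide.\<close>

lemma heat1_mult_le:
  assumes s: "s > 0" and t: "t > 0"
  shows "heat1 s a * heat1 t b \<le> sqrt (s + t) / (sqrt s * sqrt t) * heat1 (s + t) (a - b)"
proof -
  have "(a - b)\<^sup>2 / (4 * (s + t)) \<le> a\<^sup>2 / (4 * s) + b\<^sup>2 / (4 * t)"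
    using square_add_divide_le[of "4 * s" "4 * t" a "- b"] assms by simp
  then have "exp (- a\<^sup>2 / (4 * s)) * exp (- b\<^sup>2 / (4 * t)) \<le> exp (- (a - b)\<^sup>2 / (4 * (s + t)))"
    by (simp add: exp_add[symmetric])
  moreover have "1 \<le> sqrt (4 * pi)" using pi_gt3 by simp
  then have "exp (- (a - b)\<^sup>2 / (4 * (s + t))) \<le> exp (- (a - b)\<^sup>2 / (4 * (s + t))) * sqrt (4 * pi)"
    by simp
  ultimately have "exp (- a\<^sup>2 / (4 * s)) * exp (- b\<^sup>2 / (4 * t))
      \<le> exp (- (a - b)\<^sup>2 / (4 * (s + t))) * sqrt (4 * pi)"
    by (rule order_trans)
  then have "exp (- a\<^sup>2 / (4 * s)) * exp (- b\<^sup>2 / (4 * t)) / (sqrt (4 * pi) * sqrt s * (sqrt (4 * pi) * sqrt t))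
     \<le> exp (- (a - b)\<^sup>2 / (4 * (s + t))) * sqrt (4 * pi) / (sqrt (4 * pi) * sqrt s * (sqrt (4 * pi) * sqrt t))"
    by (rule divide_right_mono) (use assms in simp)
  also have "\<dots> = sqrt (s + t) / (sqrt s * sqrt t) * (exp (- (a - b)\<^sup>2 / (4 * (s + t))) / (sqrt (4 * pi) * sqrt (s + t)))"
    using assms by (simp add: field_simps del: real_sqrt_mult)
  finally show ?thesis
    using assms by (simp only: heat1_eq add_pos_pos real_sqrt_mult[of "4 * pi"] times_divide_times_eq)
qed

text \<open>The factor 4 arises because each of the two kernels has an argument on the boundary,
  where it equals twice the heat kernel.\<close>

lemma nn_integral_bdry_Gker_mult_le:
  fixes x z :: "real^'n"
  assumes s: "s > 0" and t: "t > 0"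
  shows "(\<integral>\<^sup>+ y. ennreal (Gker k x y s * Gker k y z t) \<partial>bdry_measure k)
    \<le> ennreal (4 * (sqrt (s + t) / (sqrt s * sqrt t)) * Gker k x z (s + t))"
proof -
  let ?c = "sqrt (s + t) / (sqrt s * sqrt t)"
  have "AE y in bdry_measure k. ennreal (Gker k x y s * Gker k y z t)
      = ennreal 4 * ennreal (heat_kernel (x - y) s * heat_kernel (y - z) t)"
    using AE_bdry_measure
    by eventually_elim (subst ennreal_mult'[symmetric], simp,
        simp add: Gker_boundary_left Gker_boundary_right)
  then have "(\<integral>\<^sup>+ y. ennreal (Gker k x y s * Gker k y z t) \<partial>bdry_measure k)
      = ennreal 4 * (\<integral>\<^sup>+ y. ennreal (heat_kernel (x - y) s * heat_kernel (y - z) t) \<partial>bdry_measure k)"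
    by (subst nn_integral_cmult[symmetric], measurable) (rule nn_integral_cong_AE)
  also have "\<dots> = ennreal (4 * ((heat1 s (x $ k) * heat1 t (z $ k))
          * (\<Prod>i\<in>UNIV - {k}. heat1 (s + t) (x $ i - z $ i))))"
    by (simp only: nn_integral_bdry_heat_kernel_mult[OF s t] ennreal_mult'[symmetric] zero_le_numeral)
  also have "\<dots> \<le> ennreal (4 * ((?c * heat1 (s + t) (x $ k - z $ k))
          * (\<Prod>i\<in>UNIV - {k}. heat1 (s + t) (x $ i - z $ i))))"
    by (intro ennreal_leI mult_left_mono mult_right_mono heat1_mult_le s t prod_nonneg) auto
  also have "\<dots> = ennreal (4 * (?c * heat_kernel (x - z) (s + t)))"
    using s t by (simp add: heat_kernel_eq_prod prod_univ_remove[of _ k] mult.assoc)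
  also have "\<dots> \<le> ennreal (4 * (?c * Gker k x z (s + t)))"
    using s t by (intro ennreal_leI mult_left_mono heat_kernel_le_Gker) auto
  finally show ?thesis by (simp add: mult.assoc)
qed

text \<open>Scaling \<open>s = t * r\<close> isolates the power of \<open>t\<close> and leaves an
  Euler integral with parameters \<open>1/2 - \<beta>\<close> and \<open>1/2\<close>; \<beta> < 1/2
  is its convergence at \<open>r = 0\<close>.\<close>

lemma nn_integral_time_Beta:
  fixes \<beta> t :: real
  assumes \<beta>: "\<beta> < 1 / 2" and t: "t > 0"
  shows "(\<integral>\<^sup>+ s. ennreal (s powr (-\<beta>) * (sqrt t / (sqrt (t - s) * sqrt s))) * indicator {0<..<t} s \<partial>lborel)
    = ennreal (Beta (1 / 2 - \<beta>) (1 / 2) * t powr (1 / 2 - \<beta>))"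
proof -
  let ?f = "\<lambda>s. ennreal (s powr (-\<beta>) * (sqrt t / (sqrt (t - s) * sqrt s))) * indicator {0<..<t} s"
  let ?g = "\<lambda>r::real. r powr (1 / 2 - \<beta> - 1) * (1 - r) powr (1 / 2 - 1)"
  have "(\<integral>\<^sup>+ s. ?f s \<partial>lborel) = ennreal t * (\<integral>\<^sup>+ r. ?f (0 + t * r) \<partial>lborel)"
    by (subst nn_integral_real_affine[where c = t and t = 0]) (use t in auto)
  also have "(\<lambda>r. ?f (0 + t * r)) = (\<lambda>r. ennreal (t powr (- 1 / 2 - \<beta>)) * (ennreal (?g r) * indicator {0<..<1} r))"
  proof (rule ext)
    fix r :: real
    show "?f (0 + t * r) = ennreal (t powr (- 1 / 2 - \<beta>)) * (ennreal (?g r) * indicator {0<..<1} r)"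
    proof (cases "0 < r \<and> r < 1")
      case True
      have e: "sqrt (t - t * r) = sqrt t * sqrt (1 - r)"
        by (simp add: real_sqrt_mult[symmetric] algebra_simps)
      have "(t * r) powr (-\<beta>) * (sqrt t / (sqrt (t - t * r) * sqrt (t * r)))
          = t powr (-\<beta>) * r powr (-\<beta>) * (1 / (sqrt (1 - r) * (sqrt t * sqrt r)))"
        unfolding e using t True by (simp add: powr_mult real_sqrt_mult)
      also have "\<dots> = t powr (- \<beta>) * t powr (- (1 / 2)) * (r powr (-\<beta>) * r powr (- (1/2)) * (1 - r) powr (- (1 / 2)))"
        using t True by (simp add: powr_minus powr_half_sqrt field_simps)
      also have "\<dots> = t powr (- 1 / 2 - \<beta>) * ?g r"
      proof -
        have "t powr (- \<beta>) * t powr (- (1 / 2)) = t powr (- 1 / 2 - \<beta>)"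
          "r powr (- \<beta>) * r powr (- (1 / 2)) = r powr (1 / 2 - \<beta> - 1)"
          unfolding powr_add[symmetric] by (rule arg_cong, simp)+
        then show ?thesis by simp
      qed
      finally show ?thesis using t True
        by (simp add: ennreal_mult[symmetric])
    next
      case False
      then have "\<not> (0 < t * r \<and> t * r < t)" using t by (auto simp: zero_less_mult_iff)
      then show ?thesis using False by (auto simp: indicator_def)
    qed
  qed
  also have "(\<integral>\<^sup>+ r. ennreal (t powr (- 1 / 2 - \<beta>)) * (ennreal (?g r) * indicator {0<..<1} r) \<partial>lborel)
      = ennreal (t powr (- 1 / 2 - \<beta>)) * (\<integral>\<^sup>+ r. ennreal (?g r) * indicator {0<..<1} r \<partial>lborel)"
    by (rule nn_integral_cmult) auto
  also have "(\<integral>\<^sup>+ r. ennreal (?g r) * indicator {0<..<1} r \<partial>lborel) = ennreal (Beta (1 / 2 - \<beta>) (1 / 2))"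
    by (rule nn_integral_has_integral_lebesgue')
       (use has_integral_Beta_real[of "1 / 2 - \<beta>" "1 / 2"] \<beta> in \<open>auto simp: has_integral_Icc_iff_Ioo\<close>)
  also have "ennreal t * (ennreal (t powr (- 1 / 2 - \<beta>)) * ennreal (Beta (1 / 2 - \<beta>) (1 / 2)))
      = ennreal (t powr 1 * t powr (- 1 / 2 - \<beta>) * Beta (1 / 2 - \<beta>) (1 / 2))"
    using t by (subst ennreal_mult'[symmetric], simp)+ (simp add: mult_ac)
  also have "t powr 1 * t powr (- 1 / 2 - \<beta>) = t powr (1 / 2 - \<beta>)"
    by (simp only: powr_add[symmetric]) (simp add: field_simps)
  finally show ?thesis by (simp add: mult.commute)
qed

text \<open>The source is extended nonnegative, so the operator can be formed and compared before
  anything is known to be finite.\<close>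

definition duhamel :: "'n::finite \<Rightarrow> (real \<Rightarrow> real^'n \<Rightarrow> ennreal) \<Rightarrow> real \<Rightarrow> real^'n \<Rightarrow> ennreal" where
  "duhamel k F t x = (\<integral>\<^sup>+ s. indicator {0<..<t} s *
     (\<integral>\<^sup>+ y. ennreal (Gker k x y (t - s)) * F s y \<partial>bdry_measure k) \<partial>lborel)"

lemma duhamel_mono:
  assumes "\<And>s y. 0 < s \<Longrightarrow> s < t \<Longrightarrow> y $ k = 0 \<Longrightarrow> F s y \<le> F' s y"
  shows "duhamel k F t x \<le> duhamel k F' t x"
  unfolding duhamel_def
proof (rule nn_integral_mono)
  fix s
  have "(\<integral>\<^sup>+ y. ennreal (Gker k x y (t - s)) * F s y \<partial>bdry_measure k)
      \<le> (\<integral>\<^sup>+ y. ennreal (Gker k x y (t - s)) * F' s y \<partial>bdry_measure k)" if "s \<in> {0<..<t}"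
    using AE_bdry_measure[of k] that
    by (intro nn_integral_mono_AE) (auto elim!: eventually_mono intro!: mult_left_mono assms)
  then show "indicator {0<..<t} s * (\<integral>\<^sup>+ y. ennreal (Gker k x y (t - s)) * F s y \<partial>bdry_measure k)
      \<le> indicator {0<..<t} s * (\<integral>\<^sup>+ y. ennreal (Gker k x y (t - s)) * F' s y \<partial>bdry_measure k)"
    by (auto simp: indicator_def)
qed

text \<open>As a single integral over time and boundary, the operator inherits linearity and the
  convergence theorems in one step.\<close>

lemma duhamel_eq_pair:
  assumes [measurable]: "case_prod F \<in> borel_measurable (borel \<Otimes>\<^sub>M borel)"
  shows "duhamel k F t x = (\<integral>\<^sup>+ (s, y). ennreal (Gker k x y (t - s)) * indicator {0<..<t} s * F s y
    \<partial>(lborel \<Otimes>\<^sub>M bdry_measure k))"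
  unfolding duhamel_def
  by (subst bdry_sf.nn_integral_fst[symmetric], measurable)
     (auto simp: nn_integral_cmult[symmetric] mult_ac intro!: nn_integral_cong)

lemma duhamel_add:
  assumes [measurable]: "case_prod F \<in> borel_measurable (borel \<Otimes>\<^sub>M borel)"
    "case_prod F' \<in> borel_measurable (borel \<Otimes>\<^sub>M borel)"
  shows "duhamel k (\<lambda>s y. F s y + F' s y) t x = duhamel k F t x + duhamel k F' t x"
  by (simp add: duhamel_eq_pair nn_integral_add[symmetric] split_beta' distrib_left)

lemma duhamel_cmult:
  assumes [measurable]: "case_prod F \<in> borel_measurable (borel \<Otimes>\<^sub>M borel)"
  shows "duhamel k (\<lambda>s y. c * F s y) t x = c * duhamel k F t x"
  by (simp add: duhamel_eq_pair nn_integral_cmult[symmetric] split_beta' mult_ac)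

context weighted_measure
begin

text \<open>After Fubini the boundary integral acts on the product of two kernels with times
  \<open>t - s\<close> and \<open>s\<close>. These add up to \<open>t\<close> for every
  \<open>s\<close>, so the flow at time \<open>t\<close> factors out and only the Beta integral in
  \<open>s\<close> remains.\<close>

lemma duhamel_flow_le:
  fixes \<beta> t :: real
  assumes \<beta>: "\<beta> < 1 / 2" and t: "t > 0"
  shows "duhamel k (\<lambda>s y. ennreal (s powr (-\<beta>)) * flow k s y) t x
    \<le> ennreal (4 * Beta (1 / 2 - \<beta>) (1 / 2) * t powr (1 / 2 - \<beta>)) * flow k t x"
proof -
  interpret P: pair_sigma_finite M "bdry_measure k" ..
  let ?c = "\<lambda>s. sqrt t / (sqrt (t - s) * sqrt s)"
  have inner: "(\<integral>\<^sup>+ y. ennreal (Gker k x y (t - s)) * (ennreal (s powr (-\<beta>)) * flow k s y) \<partial>bdry_measure k)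
      \<le> ennreal (s powr (-\<beta>) * ?c s) * (ennreal 4 * flow k t x)" if s: "0 < s" "s < t" for s
  proof -
    have "(\<integral>\<^sup>+ y. ennreal (Gker k x y (t - s)) * (ennreal (s powr (-\<beta>)) * flow k s y) \<partial>bdry_measure k)
      = (\<integral>\<^sup>+ y. \<integral>\<^sup>+ z. ennreal (s powr (-\<beta>)) * (indicator (halfspace_closed k) z * h z)
            * ennreal (Gker k x y (t - s) * Gker k y z s) \<partial>M \<partial>bdry_measure k)"
      unfolding flow_def
      by (simp add: nn_integral_cmult[symmetric] ennreal_mult mult_ac)
    also have "\<dots> = (\<integral>\<^sup>+ z. \<integral>\<^sup>+ y. ennreal (s powr (-\<beta>)) * (indicator (halfspace_closed k) z * h z)
            * ennreal (Gker k x y (t - s) * Gker k y z s) \<partial>bdry_measure k \<partial>M)"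
      by (rule P.Fubini') (simp add: split_beta', measurable)
    also have "\<dots> = (\<integral>\<^sup>+ z. ennreal (s powr (-\<beta>)) * (indicator (halfspace_closed k) z * h z)
            * (\<integral>\<^sup>+ y. ennreal (Gker k x y (t - s) * Gker k y z s) \<partial>bdry_measure k) \<partial>M)"
      by (intro nn_integral_cong nn_integral_cmult) measurable
    also have "\<dots> \<le> (\<integral>\<^sup>+ z. ennreal (s powr (-\<beta>)) * (indicator (halfspace_closed k) z * h z)
            * ennreal (4 * ?c s * Gker k x z t) \<partial>M)"
      using nn_integral_bdry_Gker_mult_le[of "t - s" s k x] s
      by (intro nn_integral_mono mult_left_mono) auto
    also have "\<dots> = (\<integral>\<^sup>+ z. ennreal (s powr (-\<beta>) * ?c s) * (ennreal 4 *
          (ennreal (Gker k x z t) * indicator (halfspace_closed k) z * h z)) \<partial>M)"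
    proof (rule nn_integral_cong)
      fix z
      define c where "c = ?c s"
      have "c \<ge> 0" using s t by (simp add: c_def)
      then show "ennreal (s powr (-\<beta>)) * (indicator (halfspace_closed k) z * h z)
            * ennreal (4 * ?c s * Gker k x z t) = ennreal (s powr (-\<beta>) * ?c s) * (ennreal 4 *
          (ennreal (Gker k x z t) * indicator (halfspace_closed k) z * h z))"
        unfolding c_def[symmetric] by (simp add: ennreal_mult mult_ac)
    qed
    also have "\<dots> = ennreal (s powr (-\<beta>) * ?c s) * (ennreal 4 * flow k t x)"
      unfolding flow_def by (subst nn_integral_cmult, measurable, subst nn_integral_cmult, measurable)
    finally show ?thesis .
  qed
  have "duhamel k (\<lambda>s y. ennreal (s powr (-\<beta>)) * flow k s y) t x
      \<le> (\<integral>\<^sup>+ s. ennreal (s powr (-\<beta>) * ?c s) * indicator {0<..<t} s * (ennreal 4 * flow k t x) \<partial>lborel)"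
    unfolding duhamel_def
  proof (rule nn_integral_mono)
    fix s
    show "indicator {0<..<t} s * (\<integral>\<^sup>+ y. ennreal (Gker k x y (t - s)) * (ennreal (s powr (-\<beta>)) * flow k s y) \<partial>bdry_measure k)
        \<le> ennreal (s powr (-\<beta>) * ?c s) * indicator {0<..<t} s * (ennreal 4 * flow k t x)"
      using inner[of s] by (cases "s \<in> {0<..<t}") simp_all
  qed
  also have "\<dots> = ennreal (Beta (1 / 2 - \<beta>) (1 / 2) * t powr (1 / 2 - \<beta>)) * (ennreal 4 * flow k t x)"
    by (subst nn_integral_multc, measurable) (simp only: nn_integral_time_Beta[OF \<beta> t])
  also have "\<dots> = ennreal (4 * Beta (1 / 2 - \<beta>) (1 / 2) * t powr (1 / 2 - \<beta>)) * flow k t x"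
  proof -
    have "ennreal (4 * Beta (1 / 2 - \<beta>) (1 / 2) * t powr (1 / 2 - \<beta>))
        = ennreal (Beta (1 / 2 - \<beta>) (1 / 2) * t powr (1 / 2 - \<beta>)) * ennreal 4"
      by (subst ennreal_mult''[symmetric]) (auto simp: mult_ac)
    then show ?thesis by (simp only: mult.assoc)
  qed
  finally show ?thesis .
qed

end

section \<open>Continuity\<close>

text \<open>Dominated convergence along sequences. The integrable bound also keeps the limit finite,
  which matters because \<open>enn2real\<close> sends infinity to 0 and is not continuous
  there.\<close>

lemma continuous_on_enn2real_nn_integral:
  fixes f :: "'p::{first_countable_topology, t2_space} \<Rightarrow> 'b \<Rightarrow> ennreal"
  assumes [measurable]: "\<And>p. p \<in> A \<Longrightarrow> f p \<in> borel_measurable M" "W \<in> borel_measurable M"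
    and W: "\<And>p y. p \<in> A \<Longrightarrow> y \<in> space M \<Longrightarrow> f p y \<le> W y" "(\<integral>\<^sup>+ y. W y \<partial>M) < \<infinity>"
    and cont: "\<And>y. y \<in> space M \<Longrightarrow> continuous_on A (\<lambda>p. f p y)"
  shows "continuous_on A (\<lambda>p. enn2real (\<integral>\<^sup>+ y. f p y \<partial>M))"
proof (rule continuous_on_sequentiallyI)
  fix u a assume u: "\<forall>n. u n \<in> A" "a \<in> A" "u \<longlonglongrightarrow> a"
  have fa: "(\<integral>\<^sup>+ y. f a y \<partial>M) < \<infinity>"
    using W(1)[OF u(2)] W(2) by (auto intro: le_less_trans[OF nn_integral_mono])
  have "(\<lambda>n. \<integral>\<^sup>+ y. f (u n) y \<partial>M) \<longlonglongrightarrow> (\<integral>\<^sup>+ y. f a y \<partial>M)"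
  proof (rule nn_integral_dominated_convergence[where w = W])
    show "AE y in M. (\<lambda>n. f (u n) y) \<longlonglongrightarrow> f a y"
      using u cont unfolding continuous_on_sequentially comp_def by auto
  qed (use u W in auto)
  then show "(\<lambda>n. enn2real (\<integral>\<^sup>+ y. f (u n) y \<partial>M)) \<longlonglongrightarrow> enn2real (\<integral>\<^sup>+ y. f a y \<partial>M)"
    using fa by (intro tendsto_enn2real) auto
qed

text \<open>Dominating functions exist only for bounded \<open>x\<close> and times kept away from 0
  and \<open>T\<close>; continuity is local, so this is enough.\<close>

lemma continuous_on_strip:
  fixes f :: "'a::real_normed_vector \<times> real \<Rightarrow> 'b::topological_space"
  assumes "\<And>R t1 t2. 0 < t1 \<Longrightarrow> t1 < t2 \<Longrightarrow> t2 < T \<Longrightarrow> continuous_on (ball 0 R \<times> {t1<..<t2}) f"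
  shows "continuous_on (UNIV \<times> {0<..<T}) f"
proof (intro continuous_at_imp_continuous_on ballI)
  fix z :: "'a \<times> real" assume "z \<in> UNIV \<times> {0<..<T}"
  then obtain x t where z: "z = (x, t)" "0 < t" "t < T" by auto
  have "continuous_on (ball 0 (norm x + 1) \<times> {t / 2<..<(t + T) / 2}) f"
    using z by (intro assms) auto
  moreover have "open (ball (0::'a) (norm x + 1) \<times> {t / 2<..<(t + T) / 2})"
    by (intro open_Times) auto
  moreover have "z \<in> ball 0 (norm x + 1) \<times> {t / 2<..<(t + T) / 2}"
    using z by auto
  ultimately show "isCont f z" by (metis continuous_on_eq_continuous_at)
qed

text \<open>A later time absorbs a shift of the centre:
  \<open>|y|^2/t <= |x-y|^2/s + |x|^2/(t-s)\<close>, with at least \<open>d\<close> of extra time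
  available. The bound is uniform in \<open>x\<close> and \<open>s\<close> and so supplies the
  dominating functions for finiteness and continuity alike.\<close>

lemma heat_kernel_le_origin:
  fixes x y :: "real^'n"
  assumes a: "0 < a" "a \<le> s" and d: "0 < d" "s + d \<le> t" and x: "norm x \<le> R"
  shows "heat_kernel (x - y) s \<le> (t / a) powr (real CARD('n) / 2) * exp (R\<^sup>2 / (4 * d)) * heat_kernel y t"
proof -
  have s: "0 < s" and t: "s < t" using a d by auto
  have "(norm y)\<^sup>2 \<le> (norm (x - y) + norm x)\<^sup>2"
    using norm_triangle_ineq4[of x "x - y"] by (intro power_mono) (auto simp: add.commute)
  then have "(norm y)\<^sup>2 / (4 * t) \<le> (norm (x - y) + norm x)\<^sup>2 / (4 * s + 4 * (t - s))"
    using t s by (auto intro!: divide_right_mono)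
  also have "\<dots> \<le> (norm (x - y))\<^sup>2 / (4 * s) + (norm x)\<^sup>2 / (4 * (t - s))"
    using s t by (intro square_add_divide_le) auto
  also have "(norm x)\<^sup>2 / (4 * (t - s)) \<le> R\<^sup>2 / (4 * d)"
    using d x by (intro frac_le power_mono) auto
  finally have e: "exp (- (norm (x - y))\<^sup>2 / (4 * s)) \<le> exp (R\<^sup>2 / (4 * d)) * exp (- (norm y)\<^sup>2 / (4 * t))"
    by (simp add: exp_add[symmetric])
  have "(4 * pi * s) powr (- real CARD('n) / 2) \<le> (4 * pi * a) powr (- real CARD('n) / 2)"
    using a by (intro powr_mono2') auto
  also have "4 * pi * a = (a / t) * (4 * pi * t)" using s t by simp
  also have "((a / t) * (4 * pi * t)) powr (- real CARD('n) / 2)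
      = (a / t) powr (- (real CARD('n) / 2)) * (4 * pi * t) powr (- real CARD('n) / 2)"
    by (simp only: powr_mult) simp
  also have "(a / t) powr (- (real CARD('n) / 2)) = (t / a) powr (real CARD('n) / 2)"
    using a s t by (simp add: powr_minus_divide powr_divide)
  finally have p: "(4 * pi * s) powr (- real CARD('n) / 2)
     \<le> (t / a) powr (real CARD('n) / 2) * (4 * pi * t) powr (- real CARD('n) / 2)" .
  show ?thesis unfolding heat_kernel_def
    using mult_mono[OF p e] by (simp add: mult_ac)
qed

lemma Gker_le_origin:
  fixes x y :: "real^'n"
  assumes "0 < a" "a \<le> s" "0 < d" "s + d \<le> t" "norm x \<le> R"
  shows "Gker k x y s \<le> (t / a) powr (real CARD('n) / 2) * exp (R\<^sup>2 / (4 * d)) * Gker k 0 y t"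
proof -
  have n: "heat_kernel (reflect k y) t = heat_kernel y t" "heat_kernel (- z) t = heat_kernel z t" for z :: "real^'n"
    by (simp_all add: heat_kernel_def)
  show ?thesis
    using heat_kernel_le_origin[OF assms, of y] heat_kernel_le_origin[OF assms, of "reflect k y"]
    by (simp add: Gker_def n distrib_left)
qed

lemma continuous_on_Gker [continuous_intros]:
  assumes "continuous_on A f" "continuous_on A g" "\<And>z. z \<in> A \<Longrightarrow> g z > 0"
  shows "continuous_on A (\<lambda>z. Gker k (f z) y (g z))"
  unfolding Gker_def heat_kernel_def
  by (intro continuous_intros assms) (use assms(3) in \<open>force+\<close>)

context weighted_measure
begin

text \<open>Finiteness at the single point 0 spreads to all of space at the price of a slightly
  later time, which is available because the time interval is open at \<open>T\<close>.\<close>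

lemma flow_finite:
  assumes "\<And>t. 0 < t \<Longrightarrow> t < T \<Longrightarrow> flow k t 0 < \<infinity>" "0 < t" "t < T"
  shows "flow k t x < \<infinity>"
proof -
  obtain t' where t': "t < t'" "t' < T" using dense[OF assms(3)] by blast
  define C where "C = (t' / t) powr (real CARD('n) / 2) * exp ((norm x)\<^sup>2 / (4 * (t' - t)))"
  have "flow k t x \<le> (\<integral>\<^sup>+ y. ennreal C * (ennreal (Gker k 0 y t') * indicator (halfspace_closed k) y * h y) \<partial>M)"
    unfolding flow_def
  proof (rule nn_integral_mono)
    fix y
    have "Gker k x y t \<le> C * Gker k 0 y t'"
      unfolding C_def by (rule Gker_le_origin) (use assms t' in auto)
    then have "ennreal (Gker k x y t) \<le> ennreal C * ennreal (Gker k 0 y t')"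
      by (simp add: ennreal_mult''[symmetric] ennreal_leI)
    then show "ennreal (Gker k x y t) * indicator (halfspace_closed k) y * h y
        \<le> ennreal C * (ennreal (Gker k 0 y t') * indicator (halfspace_closed k) y * h y)"
      unfolding mult.assoc[symmetric] by (intro mult_right_mono) auto
  qed
  also have "\<dots> = ennreal C * flow k t' 0"
    unfolding flow_def by (rule nn_integral_cmult) measurable
  also have "\<dots> < \<infinity>"
    using assms t' by (simp add: ennreal_mult_less_top)
  finally show ?thesis .
qed

lemma continuous_on_flow:
  assumes fin: "\<And>t. 0 < t \<Longrightarrow> t < T \<Longrightarrow> flow k t 0 < \<infinity>"
    and h: "\<And>y. h y < \<infinity>"
  shows "continuous_on (UNIV \<times> {0<..<T}) (\<lambda>(x, t). enn2real (flow k t x))"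
proof (rule continuous_on_strip)
  fix R t1 t2 :: real assume t: "0 < t1" "t1 < t2" "t2 < T"
  obtain t' where t': "t2 < t'" "t' < T" using dense[OF t(3)] by blast
  define C where "C = (t' / t1) powr (real CARD('n) / 2) * exp (R\<^sup>2 / (4 * (t' - t2)))"
  have "continuous_on (ball 0 R \<times> {t1<..<t2}) (\<lambda>z. enn2real (\<integral>\<^sup>+ y. ennreal (Gker k (fst z) y (snd z))
      * indicator (halfspace_closed k) y * h y \<partial>M))"
  proof (rule continuous_on_enn2real_nn_integral)
    show "(\<integral>\<^sup>+ y. ennreal C * (ennreal (Gker k 0 y t') * indicator (halfspace_closed k) y * h y) \<partial>M) < \<infinity>"
      using fin[of t'] t t' unfolding flow_def
      by (subst nn_integral_cmult) (auto simp: ennreal_mult_less_top)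
  next
    fix z y assume z: "z \<in> ball (0::real^'n) R \<times> {t1<..<t2}"
    then have "Gker k (fst z) y (snd z) \<le> C * Gker k 0 y t'"
      unfolding C_def using t t' by (intro Gker_le_origin) auto
    then have "ennreal (Gker k (fst z) y (snd z)) \<le> ennreal C * ennreal (Gker k 0 y t')"
      by (simp add: ennreal_mult''[symmetric] ennreal_leI)
    then show "ennreal (Gker k (fst z) y (snd z)) * indicator (halfspace_closed k) y * h y
        \<le> ennreal C * (ennreal (Gker k 0 y t') * indicator (halfspace_closed k) y * h y)"
      unfolding mult.assoc[symmetric] by (intro mult_right_mono) auto
  next
    fix y
    have "continuous_on (ball (0::real^'n) R \<times> {t1<..<t2}) (\<lambda>z. ennreal (Gker k (fst z) y (snd z)
      * indicator (halfspace_closed k) y * enn2real (h y)))"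
      by (intro continuous_on_ennreal continuous_intros) (use t in auto)
    moreover have "ennreal (Gker k (fst z) y (snd z) * indicator (halfspace_closed k) y * enn2real (h y))
       = ennreal (Gker k (fst z) y (snd z)) * indicator (halfspace_closed k) y * h y" for z
      using h[of y] by (simp add: ennreal_mult ennreal_indicator less_top)
    ultimately show "continuous_on (ball (0::real^'n) R \<times> {t1<..<t2}) (\<lambda>z. ennreal (Gker k (fst z) y (snd z))
      * indicator (halfspace_closed k) y * h y)" by simp
  qed measurable
  then show "continuous_on (ball 0 R \<times> {t1<..<t2}) (\<lambda>(x, t). enn2real (flow k t x))"
    by (simp add: flow_def split_beta')
qed

end

section \<open>Continuity of the Duhamel term\<close>

lemma nn_integral_inverse_sqrt:
  assumes "c > 0"
  shows "(\<integral>\<^sup>+ s. ennreal (1 / sqrt (t - s)) * indicator {t - c<..<t} s \<partial>lborel) = ennreal (2 * sqrt c)"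
proof -
  have "(\<integral>\<^sup>+ s. ennreal (1 / sqrt (t - s)) * indicator {t - c<..<t} s \<partial>lborel)
     = (\<integral>\<^sup>+ r. ennreal (r powr (- 1 / 2)) * indicator {0<..<c} r \<partial>lborel)"
    by (subst nn_integral_real_affine[where c = "-1" and t = t])
       (auto intro!: nn_integral_cong simp: indicator_def powr_minus_divide powr_half_sqrt[symmetric])
  also have "\<dots> = ennreal (c powr (- 1 / 2 + 1) / (- 1 / 2 + 1))"
    by (rule nn_integral_has_integral_lebesgue')
       (use has_integral_powr_from_0[of "- 1 / 2" c] assms in \<open>auto simp: has_integral_Icc_iff_Ioo\<close>)
  also have "c powr (- 1 / 2 + 1) / (- 1 / 2 + 1) = 2 * sqrt c"
    using assms by (simp add: powr_half_sqrt)
  finally show ?thesis .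
qed

lemma heat1_le_inverse_sqrt: "t > 0 \<Longrightarrow> heat1 t a \<le> 1 / sqrt t"
proof -
  assume t: "t > 0"
  have "sqrt t \<le> sqrt (4 * pi * t)" using t pi_gt3 by (intro real_sqrt_le_mono) simp
  then have "exp (- a\<^sup>2 / (4 * t)) / sqrt (4 * pi * t) \<le> 1 / sqrt t"
    using t by (intro frac_le) auto
  then show ?thesis using t by (simp only: heat1_eq)
qed

text \<open>At time lag \<open>t - s\<close> the boundary mass of the kernel is at most
  \<open>2 / sqrt (t - s)\<close>. The resulting bound is uniform in \<open>x\<close> and
  \<open>t\<close>, which later turns a cutoff error into uniform convergence.\<close>

lemma nn_integral_bdry_Gker_recent_le:
  assumes c: "c > 0"
  shows "(\<integral>\<^sup>+ s. indicator {t - c<..<t} s * (\<integral>\<^sup>+ y. ennreal (Gker k x y (t - s)) \<partial>bdry_measure k) \<partial>lborel)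
    \<le> ennreal (4 * sqrt c)"
proof -
  have inner: "(\<integral>\<^sup>+ y. ennreal (Gker k x y (t - s)) \<partial>bdry_measure k) \<le> ennreal 2 * ennreal (1 / sqrt (t - s))"
    if "s < t" for s
  proof -
    have "(\<integral>\<^sup>+ y. ennreal (Gker k x y (t - s)) \<partial>bdry_measure k)
        = (\<integral>\<^sup>+ y. ennreal 2 * ennreal (heat_kernel (x - y) (t - s)) \<partial>bdry_measure k)"
      using AE_bdry_measure[of k]
      by (intro nn_integral_cong_AE)
         (auto elim!: eventually_mono simp: Gker_boundary_right ennreal_mult'[symmetric] simp del: ennreal_numeral)
    also have "\<dots> = ennreal 2 * ennreal (heat1 (t - s) (x $ k))"
      using that by (simp add: nn_integral_cmult nn_integral_bdry_heat_kernel)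
    also have "\<dots> \<le> ennreal 2 * ennreal (1 / sqrt (t - s))"
      using that by (intro mult_left_mono ennreal_leI heat1_le_inverse_sqrt) auto
    finally show ?thesis .
  qed
  have "(\<integral>\<^sup>+ s. indicator {t - c<..<t} s * (\<integral>\<^sup>+ y. ennreal (Gker k x y (t - s)) \<partial>bdry_measure k) \<partial>lborel)
     \<le> (\<integral>\<^sup>+ s. ennreal 2 * (ennreal (1 / sqrt (t - s)) * indicator {t - c<..<t} s) \<partial>lborel)"
    using inner by (intro nn_integral_mono) (auto simp: indicator_def)
  also have "\<dots> = ennreal 2 * ennreal (2 * sqrt c)"
    by (subst nn_integral_cmult) (auto simp: nn_integral_inverse_sqrt[OF c])
  also have "\<dots> = ennreal (4 * sqrt c)"
    using c by (subst ennreal_mult'[symmetric]) auto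
  finally show ?thesis .
qed

lemma continuous_on_duhamel:
  fixes f :: "real \<Rightarrow> real^'n \<Rightarrow> real"
  assumes f[measurable]: "case_prod f \<in> borel_measurable (borel \<Otimes>\<^sub>M borel)"
    and f0: "\<And>s y. f s y \<ge> 0"
    and fin: "\<And>t x. 0 < t \<Longrightarrow> t < T \<Longrightarrow> duhamel k (\<lambda>s y. ennreal (f s y)) t x < \<infinity>"
    and bdd: "\<And>a. 0 < a \<Longrightarrow> \<exists>K. \<forall>s y. a \<le> s \<longrightarrow> s < T \<longrightarrow> y $ k = 0 \<longrightarrow> f s y \<le> K"
  shows "continuous_on (UNIV \<times> {0<..<T}) (\<lambda>(x, t). enn2real (duhamel k (\<lambda>s y. ennreal (f s y)) t x))"
proof (rule continuous_on_strip)
  fix R t1 t2 :: real assume t: "0 < t1" "t1 < t2" "t2 < T"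
  define A where "A = ball (0::real^'n) R \<times> {t1<..<t2}"
  obtain t' where t': "t2 < t'" "t' < T" using dense[OF t(3)] by blast
  obtain K where K: "\<And>s y. t1 / 2 \<le> s \<Longrightarrow> s < T \<Longrightarrow> y $ k = 0 \<Longrightarrow> f s y \<le> K"
    using bdd[of "t1 / 2"] t by auto
  define K' where "K' = max K 0"
  \<comment> \<open>With \<eta> at most \<open>t1 / 4\<close> the window of length
    \<open>2 * \<eta>\<close> before any time after \<open>t1\<close> stays to the right of
    \<open>t1 / 2\<close>, where \<open>K\<close> bounds the source.\<close>
  define \<eta> where "\<eta> n = t1 / 4 / real (Suc n)" for n
  have \<eta>: "0 < \<eta> n" "\<eta> n \<le> t1 / 4" for n
    using t by (auto simp: \<eta>_def field_simps)
  let ?Q = "lborel \<Otimes>\<^sub>M bdry_measure k"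
  \<comment> \<open>The cutoff removes the singularity of the kernel at \<open>s = t\<close>; the removed part is \<open>O(sqrt \<eta>)\<close> because
    \<open>f\<close> is bounded on the boundary near time \<open>t\<close>.\<close>
  define \<phi> where "\<phi> n t s = min 1 (max 0 ((t - s) / \<eta> n - 1))" for n and t s :: real
  \<comment> \<open>The maximum keeps the kernel time positive, so the integrand is continuous in
    \<open>z\<close> even where the cutoff vanishes; where the cutoff is nonzero the maximum changes
    nothing.\<close>
  define J where "J n z q = ennreal (Gker k (fst z) (snd q) (max (\<eta> n) (snd z - fst q)) * \<phi> n (snd z) (fst q)
      * f (fst q) (snd q)) * indicator {0<..} (fst q)" for n and z :: "(real^'n) \<times> real" and q :: "real \<times> (real^'n)"
  define V where "V n z = (\<integral>\<^sup>+ q. J n z q \<partial>?Q)" for n z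
  let ?F = "\<lambda>z :: (real^'n) \<times> real. duhamel k (\<lambda>s y. ennreal (f s y)) (snd z) (fst z)"
  have f'[measurable]: "(\<lambda>q. f (fst q) (snd q)) \<in> borel_measurable (borel \<Otimes>\<^sub>M borel)"
    using f by (simp add: split_beta')
  have \<phi>01: "0 \<le> \<phi> n t s" "\<phi> n t s \<le> 1" for n t s by (auto simp: \<phi>_def)
  have \<phi>_0: "\<phi> n t s = 0" if "t - s \<le> \<eta> n" for n t s
    using that \<eta>[of n] by (simp add: \<phi>_def divide_le_eq)
  have \<phi>_1: "\<phi> n t s = 1" if "2 * \<eta> n \<le> t - s" for n t s
    using that \<eta>[of n] by (simp add: \<phi>_def le_divide_eq min_def max_def)
  have [measurable]: "(\<lambda>q. \<phi> n t (fst q)) \<in> borel_measurable (borel \<Otimes>\<^sub>M borel)" for n t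
    unfolding \<phi>_def by measurable
  have Jm[measurable]: "J n z \<in> borel_measurable ?Q" for n z
    unfolding J_def by measurable
  have pair: "?F z = (\<integral>\<^sup>+ q. ennreal (Gker k (fst z) (snd q) (snd z - fst q)) * indicator {0<..<snd z} (fst q)
        * ennreal (f (fst q) (snd q)) \<partial>?Q)" for z
    by (subst duhamel_eq_pair) (auto simp: split_beta')
  have J_le: "J n z q \<le> ennreal (Gker k (fst z) (snd q) (snd z - fst q)) * indicator {0<..<snd z} (fst q)
        * ennreal (f (fst q) (snd q))" for n z q
  proof (cases "\<eta> n < snd z - fst q")
    case True
    have "Gker k (fst z) (snd q) (snd z - fst q) * \<phi> n (snd z) (fst q) * f (fst q) (snd q)
       \<le> Gker k (fst z) (snd q) (snd z - fst q) * 1 * f (fst q) (snd q)"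
      by (intro mult_right_mono mult_left_mono \<phi>01 f0) auto
    then show ?thesis using True \<eta>[of n] f0
      by (auto simp: J_def indicator_def ennreal_mult[symmetric] ennreal_leI)
  next
    case False
    then show ?thesis by (simp add: J_def \<phi>_0)
  qed
  have contV: "continuous_on A (\<lambda>z. enn2real (V n z))" for n
    unfolding V_def
  proof (rule continuous_on_enn2real_nn_integral)
    \<comment> \<open>The dominating function is the full Duhamel integrand at the origin and time
      \<open>t'\<close>. Its kernel time exceeds that of \<open>J\<close> by at least
      \<open>t' - t2\<close>, whatever \<open>q\<close> is, and it is integrable by the finiteness
      assumption.\<close>
    define C where "C = (t' / \<eta> n) powr (real CARD('n) / 2) * exp (R\<^sup>2 / (4 * (t' - t2)))"
    define W where "W q = ennreal C * (ennreal (Gker k 0 (snd q) (t' - fst q)) * indicator {0<..<t'} (fst q)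
        * ennreal (f (fst q) (snd q)))" for q
    have C0: "C \<ge> 0" by (simp add: C_def)
    show [measurable]: "W \<in> borel_measurable ?Q"
      unfolding W_def by measurable
    have "(\<integral>\<^sup>+ q. W q \<partial>?Q) = ennreal C * ?F (0, t')"
      unfolding W_def pair by (subst nn_integral_cmult) auto
    also have "\<dots> < \<infinity>"
      using fin[of t' 0] t t' by (simp add: ennreal_mult_less_top)
    finally show "(\<integral>\<^sup>+ q. W q \<partial>?Q) < \<infinity>" .
    fix q :: "real \<times> (real^'n)"
    show "J n z q \<le> W q" if z: "z \<in> A" for z
    proof (cases "\<eta> n < snd z - fst q \<and> fst q > 0")
      case True
      have "Gker k (fst z) (snd q) (snd z - fst q)
          \<le> ((t' - fst q) / \<eta> n) powr (real CARD('n) / 2) * exp (R\<^sup>2 / (4 * (t' - t2))) * Gker k 0 (snd q) (t' - fst q)"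
        using z t t' True \<eta>[of n] by (intro Gker_le_origin) (auto simp: A_def)
      also have "\<dots> \<le> C * Gker k 0 (snd q) (t' - fst q)"
        unfolding C_def using z t t' True \<eta>[of n]
        by (intro mult_right_mono powr_mono2 divide_right_mono) (auto simp: A_def)
      finally have G: "Gker k (fst z) (snd q) (snd z - fst q) \<le> C * Gker k 0 (snd q) (t' - fst q)" .
      have "J n z q \<le> ennreal (Gker k (fst z) (snd q) (snd z - fst q)) * indicator {0<..<snd z} (fst q)
        * ennreal (f (fst q) (snd q))" by (rule J_le)
      also have "\<dots> \<le> ennreal (C * Gker k 0 (snd q) (t' - fst q)) * indicator {0<..<t'} (fst q)
        * ennreal (f (fst q) (snd q))"
        using G z t' by (intro mult_right_mono mult_mono ennreal_leI) (auto simp: indicator_def A_def)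
      also have "\<dots> = W q"
        unfolding W_def using C0 by (simp add: ennreal_mult mult.assoc)
      finally show ?thesis .
    next
      case False
      then show ?thesis by (auto simp: J_def \<phi>_0)
    qed
    have "continuous_on A (\<lambda>z. Gker k (fst z) (snd q) (max (\<eta> n) (snd z - fst q)) * \<phi> n (snd z) (fst q)
      * f (fst q) (snd q) * indicator {0<..} (fst q))"
      unfolding \<phi>_def using \<eta>[of n]
      by (intro continuous_intros) (auto simp: less_max_iff_disj)
    then have "continuous_on A (\<lambda>z. ennreal (Gker k (fst z) (snd q) (max (\<eta> n) (snd z - fst q)) * \<phi> n (snd z) (fst q)
      * f (fst q) (snd q) * indicator {0<..} (fst q)))"
      by (rule continuous_on_ennreal)
    moreover have "ennreal (Gker k (fst z) (snd q) (max (\<eta> n) (snd z - fst q)) * \<phi> n (snd z) (fst q)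
      * f (fst q) (snd q) * indicator {0<..} (fst q)) = J n z q" for z
      unfolding J_def by (simp add: indicator_def)
    ultimately show "continuous_on A (\<lambda>z. J n z q)" by simp
  qed (rule Jm)
  have V_le: "V n z \<le> ?F z" for n z
    unfolding V_def pair by (intro nn_integral_mono J_le)
  have le_V: "?F z \<le> V n z + ennreal (K' * (4 * sqrt (2 * \<eta> n)))" if z: "z \<in> A" for n z
  proof -
    let ?G = "\<lambda>q. ennreal (Gker k (fst z) (snd q) (snd z - fst q))"
    have "?F z \<le> (\<integral>\<^sup>+ q. J n z q + ennreal K' * (indicator {snd z - 2 * \<eta> n<..<snd z} (fst q) * ?G q) \<partial>?Q)"
      unfolding pair
    proof (rule nn_integral_mono_AE)
      have "AE q in ?Q. snd q $ k = 0"
        by (rule lborel_bdry.AE_pair_measure, measurable) (use AE_bdry_measure in auto)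
      then show "AE q in ?Q. ?G q * indicator {0<..<snd z} (fst q) * ennreal (f (fst q) (snd q))
          \<le> J n z q + ennreal K' * (indicator {snd z - 2 * \<eta> n<..<snd z} (fst q) * ?G q)"
      proof eventually_elim
        case (elim q)
        show ?case
        proof (cases "0 < fst q \<and> fst q < snd z")
          case True
          show ?thesis
          proof (cases "2 * \<eta> n \<le> snd z - fst q")
            case far: True
            then have "max (\<eta> n) (snd z - fst q) = snd z - fst q" using \<eta>[of n] by auto
            then have "J n z q = ?G q * indicator {0<..<snd z} (fst q) * ennreal (f (fst q) (snd q))"
              using True far f0 by (simp add: J_def \<phi>_1 ennreal_mult)
            then show ?thesis by simp
          next
            case near: False
            have "t1 / 2 \<le> fst q" using near z \<eta>[of n] by (auto simp: A_def)
            moreover have "fst q < T" using True z t by (auto simp: A_def)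
            ultimately have "f (fst q) (snd q) \<le> K'" using K elim by (auto simp: K'_def le_max_iff_disj)
            then have "?G q * ennreal (f (fst q) (snd q)) \<le> ?G q * ennreal K'"
              by (intro mult_left_mono ennreal_leI) auto
            then show ?thesis using True near
              by (auto simp: indicator_def mult.commute intro: add_increasing)
          qed
        next
          case False
          then show ?thesis by (auto simp: indicator_def)
        qed
      qed
    qed
    also have "\<dots> = V n z + ennreal K' * (\<integral>\<^sup>+ q. indicator {snd z - 2 * \<eta> n<..<snd z} (fst q) * ?G q \<partial>?Q)"
      unfolding V_def by (subst nn_integral_add, measurable, subst nn_integral_cmult) auto
    also have "(\<integral>\<^sup>+ q. indicator {snd z - 2 * \<eta> n<..<snd z} (fst q) * ?G q \<partial>?Q)
       = (\<integral>\<^sup>+ s. indicator {snd z - 2 * \<eta> n<..<snd z} s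
            * (\<integral>\<^sup>+ y. ennreal (Gker k (fst z) y (snd z - s)) \<partial>bdry_measure k) \<partial>lborel)"
      by (subst bdry_sf.nn_integral_fst[symmetric], measurable) (simp add: nn_integral_cmult)
    also have "V n z + ennreal K' * \<dots> \<le> V n z + ennreal K' * ennreal (4 * sqrt (2 * \<eta> n))"
      using \<eta>[of n] by (intro add_left_mono mult_left_mono nn_integral_bdry_Gker_recent_le) auto
    finally show ?thesis by (simp add: ennreal_mult'[symmetric] K'_def)
  qed
  have dist: "dist (enn2real (V n z)) (enn2real (?F z)) \<le> K' * (4 * sqrt (2 * \<eta> n))" if z: "z \<in> A" for n z
  proof -
    have F: "?F z < \<infinity>" using fin z t by (auto simp: A_def)
    have V: "V n z < \<infinity>" using V_le F by (rule le_less_trans)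
    have "enn2real (V n z) \<le> enn2real (?F z)" using V_le F by (intro enn2real_mono) auto
    moreover have "enn2real (?F z) \<le> enn2real (V n z) + K' * (4 * sqrt (2 * \<eta> n))"
    proof -
      have "enn2real (?F z) \<le> enn2real (V n z + ennreal (K' * (4 * sqrt (2 * \<eta> n))))"
        using le_V[OF z] V by (intro enn2real_mono) auto
      also have "\<dots> = enn2real (V n z) + K' * (4 * sqrt (2 * \<eta> n))"
        using V \<eta>[of n] by (subst enn2real_plus) (auto simp: K'_def)
      finally show ?thesis .
    qed
    ultimately show ?thesis by (simp add: dist_real_def)
  qed
  have lim: "(\<lambda>n. K' * (4 * sqrt (2 * \<eta> n))) \<longlonglongrightarrow> K' * (4 * sqrt (2 * 0))"
    unfolding \<eta>_def
    by (intro tendsto_intros) (rule real_tendsto_divide_at_top, rule tendsto_const,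
        rule filterlim_compose[OF filterlim_real_sequentially filterlim_Suc])
  have "uniform_limit A (\<lambda>n z. enn2real (V n z)) (\<lambda>z. enn2real (?F z)) sequentially"
  proof (rule uniform_limitI)
    fix e :: real assume "e > 0"
    then have "\<forall>\<^sub>F n in sequentially. K' * (4 * sqrt (2 * \<eta> n)) < e"
      using order_tendstoD(2)[OF lim, of e] by simp
    then show "\<forall>\<^sub>F n in sequentially. \<forall>z\<in>A. dist (enn2real (V n z)) (enn2real (?F z)) < e"
      by eventually_elim (use dist in \<open>auto intro: le_less_trans\<close>)
  qed
  then have "continuous_on A (\<lambda>z. enn2real (?F z))"
    by (rule uniform_limit_theorem[rotated]) (use contV in auto)
  then show "continuous_on (ball 0 R \<times> {t1<..<t2}) (\<lambda>(x, t). enn2real (duhamel k (\<lambda>s y. ennreal (f s y)) t x))"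
    by (simp add: A_def split_beta')
qed

section \<open>Monotone iteration\<close>

lemma measurable_duhamel:
  assumes [measurable]: "case_prod F \<in> borel_measurable (borel \<Otimes>\<^sub>M borel)"
  shows "case_prod (duhamel k F) \<in> borel_measurable (borel \<Otimes>\<^sub>M borel)"
proof -
  \<comment> \<open>The interval itself depends on the variable, so the indicator is written as a
    conditional for joint measurability.\<close>
  have i: "indicator {0<..<fst z} s = (if 0 < s \<and> s < fst z then 1 else 0 :: ennreal)"
    for z :: "real \<times> (real^'a)" and s
    by (simp add: indicator_def)
  show ?thesis
    unfolding duhamel_def split_beta' i by measurable
qed

text \<open>Picard iteration from 0: the first step can only go up and the nonlinearity is monotone,
  so the iterates increase; the supersolution property keeps them below \<open>w\<close>, and
  monotone convergence passes to the limit in the integral equation.\<close>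

lemma supersolution_imp_solution:
  fixes S0 w :: "real \<Rightarrow> real^'n \<Rightarrow> ennreal" and p T :: real
  assumes p: "p > 0"
    and S0[measurable]: "case_prod S0 \<in> borel_measurable (borel \<Otimes>\<^sub>M borel)"
    and super: "\<And>t x. 0 < t \<Longrightarrow> t < T \<Longrightarrow>
      S0 t x + duhamel k (\<lambda>s y. ennreal (enn2real (w s y) powr p)) t x \<le> w t x"
    and w: "\<And>t x. 0 < t \<Longrightarrow> t < T \<Longrightarrow> w t x < \<infinity>"
  obtains u where "case_prod u \<in> borel_measurable (borel \<Otimes>\<^sub>M borel)"
    and "\<And>t x. 0 < t \<Longrightarrow> t < T \<Longrightarrow> u t x \<le> w t x"
    and "\<And>t x. 0 < t \<Longrightarrow> t < T \<Longrightarrow>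
      u t x = S0 t x + duhamel k (\<lambda>s y. ennreal (enn2real (u s y) powr p)) t x"
proof -
  \<comment> \<open>Since \<open>enn2real\<close> sends infinity to 0, \<open>P\<close> is monotone
    only below finite values. Finiteness of \<open>w\<close> on the time interval is what makes the
    comparisons legitimate.\<close>
  define P where "P v s y = ennreal (enn2real (v s y) powr p)" for v and s :: real and y :: "real^'n"
  define U where "U = rec_nat (\<lambda>_ _. 0) (\<lambda>_ v t x. S0 t x + duhamel k (P v) t x)"
  have U0: "U 0 t x = 0" and US: "U (Suc n) t x = S0 t x + duhamel k (P (U n)) t x" for n t x
    by (simp_all add: U_def)
  have Pm: "case_prod (P v) \<in> borel_measurable (borel \<Otimes>\<^sub>M borel)"
    if [measurable]: "case_prod v \<in> borel_measurable (borel \<Otimes>\<^sub>M borel)" for v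
    unfolding P_def split_beta' by measurable
  have Um[measurable]: "case_prod (U n) \<in> borel_measurable (borel \<Otimes>\<^sub>M borel)" for n
  proof (induction n)
    case 0
    then show ?case by (simp add: U0 split_beta')
  next
    case (Suc n)
    note [measurable] = measurable_duhamel[OF Pm[OF Suc]]
    show ?case by (simp add: US split_beta')
  qed
  have P_mono: "P v s y \<le> P v' s y" if "v s y \<le> v' s y" "v' s y < \<infinity>" for v v' s y
    unfolding P_def using that p by (intro ennreal_leI powr_mono2 enn2real_mono) auto
  have Uw: "U n t x \<le> w t x" if "0 < t" "t < T" for n t x
    using that
  proof (induction n arbitrary: t x)
    case 0
    then show ?case by (simp add: U0)
  next
    case (Suc n)
    have "duhamel k (P (U n)) t x \<le> duhamel k (P w) t x"
      using Suc w by (intro duhamel_mono P_mono) auto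
    then have "U (Suc n) t x \<le> S0 t x + duhamel k (P w) t x"
      unfolding US by (rule add_left_mono)
    also have "\<dots> \<le> w t x"
      unfolding P_def using Suc.prems by (rule super)
    finally show ?case .
  qed
  have Ufin: "U n t x < \<infinity>" if "0 < t" "t < T" for n t x
    using Uw[OF that] w[OF that] by (rule le_less_trans)
  have U_mono: "U n t x \<le> U (Suc n) t x" if "0 < t" "t < T" for n t x
    using that
  proof (induction n arbitrary: t x)
    case 0
    then show ?case by (simp add: U0)
  next
    case (Suc n)
    have "duhamel k (P (U n)) t x \<le> duhamel k (P (U (Suc n))) t x"
      using Suc Ufin by (intro duhamel_mono P_mono) auto
    then show ?case unfolding US by (rule add_left_mono)
  qed
  define u where "u t x = (SUP n. U n t x)" for t x
  have um[measurable]: "case_prod u \<in> borel_measurable (borel \<Otimes>\<^sub>M borel)"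
    unfolding u_def split_beta' by measurable
  have uw: "u t x \<le> w t x" if "0 < t" "t < T" for t x
    unfolding u_def using Uw[OF that] by (rule SUP_least)
  have ufin: "u t x < \<infinity>" if "0 < t" "t < T" for t x
    using uw[OF that] w[OF that] by (rule le_less_trans)
  have inc: "incseq (\<lambda>n. U n t x)" if "0 < t" "t < T" for t x
    using U_mono[OF that] by (rule incseq_SucI)
  have lim: "(\<lambda>n. U n t x) \<longlonglongrightarrow> u t x" if "0 < t" "t < T" for t x
    unfolding u_def using inc[OF that] by (rule LIMSEQ_SUP)
  have P_lim: "(\<lambda>n. P (U n) s y) \<longlonglongrightarrow> P u s y" if "0 < s" "s < T" for s y
    unfolding P_def
    using lim[OF that] ufin[OF that] p
    by (intro tendsto_intros tendsto_enn2real) auto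
  have "u t x = S0 t x + duhamel k (P u) t x" if t: "0 < t" "t < T" for t x
  proof -
    let ?Q = "lborel \<Otimes>\<^sub>M bdry_measure k"
    let ?K = "\<lambda>v q. ennreal (Gker k x (snd q) (t - fst q)) * indicator {0<..<t} (fst q) * P v (fst q) (snd q)"
    have eq: "duhamel k (P v) t x = (\<integral>\<^sup>+ q. ?K v q \<partial>?Q)"
      if "case_prod v \<in> borel_measurable (borel \<Otimes>\<^sub>M borel)" for v
      by (subst duhamel_eq_pair[OF Pm[OF that]]) (simp add: split_beta')
    have "(\<lambda>n. \<integral>\<^sup>+ q. ?K (U n) q \<partial>?Q) \<longlonglongrightarrow> (\<integral>\<^sup>+ q. ?K u q \<partial>?Q)"
    proof (rule nn_integral_LIMSEQ)
      show "incseq (\<lambda>n. ?K (U n))"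
      proof (intro incseq_SucI le_funI)
        fix n q
        show "?K (U n) q \<le> ?K (U (Suc n)) q"
        proof (cases "fst q \<in> {0<..<t}")
          case True
          then show ?thesis using t Ufin U_mono by (intro mult_left_mono P_mono) auto
        qed simp
      qed
      show "(\<lambda>n. ?K (U n) q) \<longlonglongrightarrow> ?K u q" for q
      proof (cases "fst q \<in> {0<..<t}")
        case True
        then show ?thesis using t P_lim[of "fst q" "snd q"]
          by (auto intro!: ennreal_tendsto_cmult)
      qed simp
      show "?K (U n) \<in> borel_measurable ?Q" for n
        using Pm[OF Um[of n]] by (simp add: split_beta')
    qed
    then have "(\<lambda>n. S0 t x + duhamel k (P (U n)) t x) \<longlonglongrightarrow> S0 t x + duhamel k (P u) t x"
      unfolding eq[OF Um] eq[OF um] by (intro tendsto_add tendsto_const)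
    then have "(\<lambda>n. U (Suc n) t x) \<longlonglongrightarrow> S0 t x + duhamel k (P u) t x"
      by (simp add: US)
    moreover have "(\<lambda>n. U (Suc n) t x) \<longlonglongrightarrow> u t x"
      using lim[OF t] by (rule LIMSEQ_Suc)
    ultimately show ?thesis by (rule LIMSEQ_unique[rotated])
  qed
  then show ?thesis
    using that[OF um uw] unfolding P_def by blast
qed

section \<open>Decay estimates\<close>

text \<open>Hoelder's inequality for a kernel of mass at most \<open>m\<close>, obtained by
  integrating Young's inequality pointwise with an optimised scale.\<close>

lemma nn_integral_le_powr_integral:
  fixes g :: "'a \<Rightarrow> real"
  assumes \<alpha>: "\<alpha> > 1" and m: "m > 0"
    and [measurable]: "\<kappa> \<in> borel_measurable M" "g \<in> borel_measurable M"
    and g: "\<And>y. g y \<ge> 0"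
    and mass: "(\<integral>\<^sup>+ y. \<kappa> y \<partial>M) \<le> ennreal m"
    and fin: "(\<integral>\<^sup>+ y. \<kappa> y * ennreal (g y powr \<alpha>) \<partial>M) = ennreal I" and I: "I \<ge> 0"
  shows "(\<integral>\<^sup>+ y. \<kappa> y * ennreal (g y) \<partial>M) \<le> ennreal (m powr (1 - 1 / \<alpha>) * I powr (1 / \<alpha>))"
proof (cases "I = 0")
  case True
  then have "(\<integral>\<^sup>+ y. \<kappa> y * ennreal (g y powr \<alpha>) \<partial>M) = 0"
    using fin by simp
  then have "AE y in M. \<kappa> y * ennreal (g y powr \<alpha>) = 0"
    by (rule iffD1[OF nn_integral_0_iff_AE, rotated]) measurable
  then have "AE y in M. \<kappa> y * ennreal (g y) = 0"
    by eventually_elim (use \<alpha> in \<open>auto simp: ennreal_eq_0_iff\<close>)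
  then have "(\<integral>\<^sup>+ y. \<kappa> y * ennreal (g y) \<partial>M) = 0"
    by (rule iffD2[OF nn_integral_0_iff_AE, rotated]) measurable
  then show ?thesis by simp
next
  case False
  then have I: "I > 0" using I by simp
  \<comment> \<open>The scale at which the two Young terms sum to \<open>c * m\<close>, the claimed
    bound. It would be 0 for \<open>I = 0\<close>, hence the separate case.\<close>
  define c where "c = (I / m) powr (1 / \<alpha>)"
  have c: "c > 0" using I m by (simp add: c_def)
  have c_pow: "c powr \<alpha> = I / m" using I m \<alpha> by (simp add: c_def powr_powr)
  have young: "g y \<le> c / (\<alpha> * c powr \<alpha>) * g y powr \<alpha> + c * (1 - 1 / \<alpha>)" for y
  proof -
    have "g y / c * 1 \<le> (g y / c) powr \<alpha> / \<alpha> + 1 powr (\<alpha> / (\<alpha> - 1)) / (\<alpha> / (\<alpha> - 1))"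
      using \<alpha> g c by (intro Youngs_inequality) (auto simp: field_simps)
    also have "1 powr (\<alpha> / (\<alpha> - 1)) / (\<alpha> / (\<alpha> - 1)) = 1 - 1 / \<alpha>"
      using \<alpha> by (simp add: field_simps)
    finally have "c * (g y / c) \<le> c * ((g y / c) powr \<alpha> / \<alpha> + (1 - 1 / \<alpha>))"
      using c by (intro mult_left_mono) auto
    then show ?thesis
      using c g by (simp add: powr_divide field_simps)
  qed
  have k0: "c / (\<alpha> * c powr \<alpha>) \<ge> 0" "c * (1 - 1 / \<alpha>) \<ge> 0" using c \<alpha> by auto
  have "(\<integral>\<^sup>+ y. \<kappa> y * ennreal (g y) \<partial>M)
     \<le> (\<integral>\<^sup>+ y. ennreal (c / (\<alpha> * c powr \<alpha>)) * (\<kappa> y * ennreal (g y powr \<alpha>)) + ennreal (c * (1 - 1 / \<alpha>)) * \<kappa> y \<partial>M)"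
  proof (rule nn_integral_mono)
    fix y
    have "ennreal (g y) \<le> ennreal (c / (\<alpha> * c powr \<alpha>)) * ennreal (g y powr \<alpha>) + ennreal (c * (1 - 1 / \<alpha>))"
      using young[of y] k0
      by (simp only: ennreal_mult[symmetric] ennreal_plus[symmetric] powr_ge_zero mult_nonneg_nonneg ennreal_leI)
    then have "\<kappa> y * ennreal (g y)
        \<le> \<kappa> y * (ennreal (c / (\<alpha> * c powr \<alpha>)) * ennreal (g y powr \<alpha>) + ennreal (c * (1 - 1 / \<alpha>)))"
      by (rule mult_left_mono) simp
    then show "\<kappa> y * ennreal (g y)
        \<le> ennreal (c / (\<alpha> * c powr \<alpha>)) * (\<kappa> y * ennreal (g y powr \<alpha>)) + ennreal (c * (1 - 1 / \<alpha>)) * \<kappa> y"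
      by (simp only: distrib_left mult_ac)
  qed
  also have "\<dots> = ennreal (c / (\<alpha> * c powr \<alpha>)) * ennreal I + ennreal (c * (1 - 1 / \<alpha>)) * (\<integral>\<^sup>+ y. \<kappa> y \<partial>M)"
    by (subst nn_integral_add, measurable, subst nn_integral_cmult, measurable, subst nn_integral_cmult, measurable)
       (simp only: fin)
  also have "\<dots> \<le> ennreal (c / (\<alpha> * c powr \<alpha>)) * ennreal I + ennreal (c * (1 - 1 / \<alpha>)) * ennreal m"
    by (intro add_left_mono mult_left_mono mass) simp
  also have "\<dots> = ennreal (c / (\<alpha> * c powr \<alpha>) * I + c * (1 - 1 / \<alpha>) * m)"
    using k0 m I by (simp only: ennreal_mult[symmetric] ennreal_plus[symmetric] mult_nonneg_nonneg less_imp_le)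
  also have "c / (\<alpha> * c powr \<alpha>) * I + c * (1 - 1 / \<alpha>) * m = c * m"
    unfolding c_pow using I m \<alpha> by (simp add: field_simps)
  also have "c * m = m powr (1 - 1 / \<alpha>) * I powr (1 / \<alpha>)"
    unfolding c_def using I m by (simp add: powr_divide powr_diff)
  finally show ?thesis .
qed

context weighted_measure
begin

text \<open>The reflection can be moved from the source point to the target: the image term is the
  plain heat integral evaluated at \<open>reflect k x\<close>, so a bound uniform in the centre
  serves both terms.\<close>

lemma flow_le_two_heat:
  assumes "\<And>z. (\<integral>\<^sup>+ y. ennreal (heat_kernel (z - y) t) * h y \<partial>M) \<le> A"
  shows "flow k t x \<le> 2 * A"
proof -
  have "flow k t x \<le> (\<integral>\<^sup>+ y. ennreal (heat_kernel (x - y) t) * h y + ennreal (heat_kernel (reflect k x - y) t) * h y \<partial>M)"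
    unfolding flow_def
    by (intro nn_integral_mono)
       (auto simp: indicator_def Gker_def heat_kernel_reflect distrib_right)
  also have "\<dots> = (\<integral>\<^sup>+ y. ennreal (heat_kernel (x - y) t) * h y \<partial>M)
      + (\<integral>\<^sup>+ y. ennreal (heat_kernel (reflect k x - y) t) * h y \<partial>M)"
    by (rule nn_integral_add) measurable
  also have "\<dots> \<le> A + A" by (intro add_mono assms)
  finally show ?thesis by (simp add: mult_2)
qed

end

text \<open>Since \<open>v >= 1\<close> the exponent may be raised to \<open>n\<close>, and then
  \<open>c * v / n <= exp (c * v / n)\<close> is taken to the power \<open>n\<close>.\<close>

lemma power_exp_decay:
  fixes v c :: real
  assumes "v \<ge> 1" "c > 0"
  shows "v powr (real n / 2) * exp (- c * v) \<le> (real n / c) ^ n"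
proof (cases "n = 0")
  case True
  then show ?thesis using assms by simp
next
  case False
  have "v powr (real n / 2) \<le> v powr real n"
    using assms by (intro powr_mono) auto
  also have "\<dots> = v ^ n" using assms by (simp add: powr_realpow)
  also have "v ^ n = (real n / c) ^ n * (c * v / real n) ^ n"
    using assms False by (simp add: power_mult_distrib[symmetric])
  also have "\<dots> \<le> (real n / c) ^ n * exp (c * v)"
  proof (rule mult_left_mono)
    have "(c * v / real n) ^ n \<le> exp (c * v / real n) ^ n"
    proof (rule power_mono)
      show "c * v / real n \<le> exp (c * v / real n)"
        using exp_ge_add_one_self[of "c * v / real n"] by linarith
    qed (use assms in simp)
    then show "(c * v / real n) ^ n \<le> exp (c * v)"
      using False by (simp add: exp_of_nat_mult[symmetric])
  qed (use assms in simp)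
  finally have "v powr (real n / 2) \<le> (real n / c) ^ n * exp (c * v)" .
  then have "v powr (real n / 2) * exp (- c * v) \<le> (real n / c) ^ n * exp (c * v) * exp (- c * v)"
    by (rule mult_right_mono) simp
  then show ?thesis by (simp add: mult.assoc exp_add[symmetric])
qed

text \<open>The exponent \<open>|x-y|^2 / (4 * t)\<close> is split in three. The share
  \<open>1 - \<delta>\<close> pays for the weight, because \<open>x\<close> lies on the boundary, so
  \<open>|x-y| >= y $ k\<close>, and \<open>t < T\<close>. Half of the share \<delta>, with
  \<open>|x-y|^2 >= T\<close>, gives \<open>exp (- \<delta> * T / (8 * t))\<close>, which outweighs
  the factor \<open>(T / t) powr (N/2)\<close> of the normalisation as \<open>t\<close> tends to 0.
  The other half is a Gaussian at the fixed time \<open>2 * T / \<delta>\<close>.\<close>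

lemma heat_kernel_le_weighted:
  fixes x y :: "real^'n"
  assumes t: "0 < t" "t < T" and \<delta>: "0 < \<delta>" "\<delta> < 1"
    and x: "x $ k = 0" and y: "y $ k \<ge> sqrt T"
  shows "heat_kernel (x - y) t \<le> (8 * real CARD('n) / \<delta>) ^ CARD('n) * (2 / \<delta>) powr (real CARD('n) / 2)
    * exp (- ((1 - \<delta>) / (4 * T)) * (y $ k)\<^sup>2) * heat_kernel (x - y) (2 * T / \<delta>)"
proof -
  let ?N = "real CARD('n)"
  define d where "d = (norm (x - y))\<^sup>2"
  have T: "T > 0" using t by simp
  have "\<bar>y $ k\<bar> \<le> norm (x - y)"
    using component_le_norm_cart[of "x - y" k] x by simp
  then have dy: "(y $ k)\<^sup>2 \<le> d" unfolding d_def by (metis abs_le_square_iff abs_norm_cancel)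
  have "(sqrt T)\<^sup>2 \<le> (y $ k)\<^sup>2" using y T by (intro power_mono) auto
  then have dT: "T \<le> d" using dy T by simp
  have "(1 - \<delta>) / (4 * T) * (y $ k)\<^sup>2 + \<delta> / 8 * (T / t) + \<delta> * d / (8 * T)
      \<le> (1 - \<delta>) * d / (4 * t) + \<delta> * d / (8 * t) + \<delta> * d / (8 * t)"
  proof (intro add_mono)
    have "(1 - \<delta>) / (4 * T) * (y $ k)\<^sup>2 \<le> (1 - \<delta>) / (4 * t) * d"
      using t T \<delta> dy by (intro mult_mono divide_left_mono) auto
    then show "(1 - \<delta>) / (4 * T) * (y $ k)\<^sup>2 \<le> (1 - \<delta>) * d / (4 * t)" by simp
    show "\<delta> / 8 * (T / t) \<le> \<delta> * d / (8 * t)"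
      using t \<delta> dT by (simp add: divide_right_mono mult_left_mono)
    show "\<delta> * d / (8 * T) \<le> \<delta> * d / (8 * t)"
      using t T \<delta> dT by (intro divide_left_mono) auto
  qed
  also have "\<dots> = d / (4 * t)" using t by (simp add: diff_divide_distrib algebra_simps)
  finally have e: "exp (- d / (4 * t)) \<le> exp (- ((1 - \<delta>) / (4 * T)) * (y $ k)\<^sup>2) * exp (- (\<delta> / 8) * (T / t))
      * exp (- d / (4 * (2 * T / \<delta>)))"
    using \<delta> T by (simp add: exp_add[symmetric] mult.commute)
  have p: "(4 * pi * t) powr (- ?N / 2)
      = (T / t) powr (?N / 2) * ((2 / \<delta>) powr (?N / 2) * (4 * pi * (2 * T / \<delta>)) powr (- ?N / 2))"
  proof -
    have "(4 * pi * t) powr (- ?N / 2) = ((t / T) * ((\<delta> / 2) * (4 * pi * (2 * T / \<delta>)))) powr (- ?N / 2)"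
      using T \<delta> by (simp add: mult_ac)
    also have "\<dots> = (t / T) powr (- (?N / 2)) * ((\<delta> / 2) powr (- (?N / 2)) * (4 * pi * (2 * T / \<delta>)) powr (- ?N / 2))"
      by (simp only: powr_mult minus_divide_left)
    also have "(t / T) powr (- (?N / 2)) = (T / t) powr (?N / 2)"
      using t T by (simp add: powr_minus_divide powr_divide)
    also have "(\<delta> / 2) powr (- (?N / 2)) = (2 / \<delta>) powr (?N / 2)"
      using \<delta> by (simp add: powr_minus_divide powr_divide)
    finally show ?thesis .
  qed
  have "heat_kernel (x - y) t
      \<le> (4 * pi * t) powr (- ?N / 2) * (exp (- ((1 - \<delta>) / (4 * T)) * (y $ k)\<^sup>2) * exp (- (\<delta> / 8) * (T / t))
      * exp (- d / (4 * (2 * T / \<delta>))))"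
    unfolding heat_kernel_def d_def[symmetric] using e by (rule mult_left_mono) simp
  also have "\<dots> = ((T / t) powr (?N / 2) * exp (- (\<delta> / 8) * (T / t))) * (2 / \<delta>) powr (?N / 2)
      * exp (- ((1 - \<delta>) / (4 * T)) * (y $ k)\<^sup>2) * heat_kernel (x - y) (2 * T / \<delta>)"
    unfolding heat_kernel_def d_def[symmetric] p by (simp only: mult_ac)
  also have "\<dots> \<le> (?N / (\<delta> / 8)) ^ CARD('n) * (2 / \<delta>) powr (?N / 2)
      * exp (- ((1 - \<delta>) / (4 * T)) * (y $ k)\<^sup>2) * heat_kernel (x - y) (2 * T / \<delta>)"
    using t \<delta> by (intro mult_right_mono power_exp_decay) auto
  finally show ?thesis by (simp add: mult.commute)
qed

text \<open>The factors are, in order: 2 for the kernel at a boundary point, the constant of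
  \<open>heat_kernel_le_weighted\<close>, and the averaging constant for radius
  \<open>sqrt T\<close> and time \<open>2 * T / \<delta>\<close>, whose exponent is \<delta> /
  32.\<close>

definition decay_const :: "real \<Rightarrow> nat \<Rightarrow> real" where
  "decay_const \<delta> n = 2 * ((8 * real n / \<delta>) ^ n * (2 / \<delta>) powr (real n / 2))
     * (exp (\<delta> / 32) * 2 powr (3 * real n / 2))"

text \<open>Once the kernel has been traded for the weight and a Gaussian at time
  \<open>2 * T / \<delta>\<close>, that time is comparable to the squared radius \<open>T\<close>,
  so averaging costs a constant free of \<open>t\<close> and \<open>T\<close>. The weight enters as
  the density of a second interpretation.\<close>

lemma flow_boundary_le_weighted_average:
  fixes M :: "(real^'n) measure"
  assumes "weighted_measure M (\<lambda>_. 1)" and t: "0 < t" "t < T" and \<delta>: "0 < \<delta>" "\<delta> < 1"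
    and supp: "AE y in M. y \<in> D_L k T"
    and A: "\<And>x. x \<in> D_L k T \<Longrightarrow>
       (\<integral>\<^sup>+ y. ennreal (exp (- ((1 - \<delta>) / (4 * T)) * (y $ k)\<^sup>2)) * indicator (ball x (sqrt T)) y \<partial>M)
          / emeasure lebesgue (ball x (sqrt T)) \<le> A"
    and x: "x $ k = 0"
  shows "weighted_measure.flow M (\<lambda>_. 1) k t x \<le> ennreal (decay_const \<delta> CARD('n)) * A"
proof -
  interpret W1: weighted_measure M "\<lambda>_. 1" by fact
  define e where "e y = ennreal (exp (- ((1 - \<delta>) / (4 * T)) * (y $ k)\<^sup>2))" for y :: "real^'n"
  have [measurable]: "e \<in> borel_measurable borel" unfolding e_def by measurable
  interpret We: weighted_measure M e
    by unfold_locales (rule W1.sets_M, measurable)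
  define C where "C = (8 * real CARD('n) / \<delta>) ^ CARD('n) * (2 / \<delta>) powr (real CARD('n) / 2)"
  have C0: "C \<ge> 0" using \<delta> by (simp add: C_def)
  have T: "T > 0" using t by simp
  have "W1.flow k t x \<le> (\<integral>\<^sup>+ y. ennreal (2 * C) * (ennreal (heat_kernel (x - y) (2 * T / \<delta>)) * e y) \<partial>M)"
    unfolding W1.flow_def
  proof (rule nn_integral_mono_AE, use supp in eventually_elim)
    fix y assume "y \<in> D_L k T"
    then have "heat_kernel (x - y) t \<le> C * exp (- ((1 - \<delta>) / (4 * T)) * (y $ k)\<^sup>2) * heat_kernel (x - y) (2 * T / \<delta>)"
      unfolding C_def by (intro heat_kernel_le_weighted t \<delta> x) (simp add: D_L_def)
    then have "Gker k x y t \<le> 2 * C * (heat_kernel (x - y) (2 * T / \<delta>) * exp (- ((1 - \<delta>) / (4 * T)) * (y $ k)\<^sup>2))"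
      using x by (simp add: Gker_boundary_left mult_ac)
    then have "ennreal (Gker k x y t) \<le> ennreal (2 * C) * (ennreal (heat_kernel (x - y) (2 * T / \<delta>)) * e y)"
      unfolding e_def using C0 by (simp add: ennreal_mult[symmetric] ennreal_leI del: ennreal_numeral)
    then show "ennreal (Gker k x y t) * indicator (halfspace_closed k) y * 1
        \<le> ennreal (2 * C) * (ennreal (heat_kernel (x - y) (2 * T / \<delta>)) * e y)"
      by (auto simp: indicator_def)
  qed
  also have "\<dots> = ennreal (2 * C) * (\<integral>\<^sup>+ y. ennreal (heat_kernel (x - y) (2 * T / \<delta>)) * e y \<partial>M)"
    by (rule nn_integral_cmult) measurable
  also have "\<dots> \<le> ennreal (2 * C) * (ennreal (exp ((sqrt T)\<^sup>2 / (16 * (2 * T / \<delta>))) * 2 powr (3 * real CARD('n) / 2)) * A)"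
    by (intro mult_left_mono We.nn_integral_heat_kernel_le_average[where S = "D_L k T"])
       (use T \<delta> A supp in \<open>auto simp: e_def\<close>)
  also have "(sqrt T)\<^sup>2 / (16 * (2 * T / \<delta>)) = \<delta> / 32"
    using T \<delta> by simp
  also have "ennreal (2 * C) * (ennreal (exp (\<delta> / 32) * 2 powr (3 * real CARD('n) / 2)) * A)
     = ennreal (decay_const \<delta> CARD('n)) * A"
  proof -
    have "ennreal (decay_const \<delta> CARD('n)) = ennreal (2 * C) * ennreal (exp (\<delta> / 32) * 2 powr (3 * real CARD('n) / 2))"
      unfolding decay_const_def C_def[symmetric] using C0 by (intro ennreal_mult) auto
    then show ?thesis by (simp only: mult.assoc)
  qed
  finally show ?thesis .
qed

section \<open>The supersolution\<close>

lemma enn_root_ennreal: "r \<ge> 0 \<Longrightarrow> enn_root a (ennreal r) = ennreal (r powr (1 / a))"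
  by (simp add: enn_root_def)

lemma powr_double_add_le:
  fixes a b p :: real
  assumes "a \<ge> 0" "b \<ge> 0" "p > 0"
  shows "(2 * a + 2 * b) powr p \<le> 4 powr p * (a powr p + b powr p)"
proof -
  have "(2 * a + 2 * b) powr p \<le> (4 * max a b) powr p"
    using assms by (intro powr_mono2) auto
  also have "\<dots> = 4 powr p * max a b powr p" by (rule powr_mult)
  also have "\<dots> \<le> 4 powr p * (a powr p + b powr p)"
    by (intro mult_left_mono) (auto simp: max_def)
  finally show ?thesis .
qed

text \<open>The data enter only through their decay, with \<open>a\<close> and \<open>b\<close>
  proportional to the smallness constant. The supersolution is a budget: of \<open>2 * A\<close> the
  linear flow uses one share and Duhamel must fit into the other (\<open>small1\<close>); of
  \<open>2 * v\<close> the linear flow uses \<open>2 powr (1 - 1/\<alpha>)\<close> and Duhamel must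
  fit into the positive rest (\<open>small2\<close>).\<close>

lemma solution_exists_if_small:
  fixes M :: "(real^'n) measure" and g :: "real^'n \<Rightarrow> real" and k :: 'n
  assumes p: "1 < p" and \<alpha>: "1 < \<alpha>" "\<alpha> < p"
    and W: "weighted_measure M (\<lambda>_. 1)"
    and g[measurable]: "g \<in> borel_measurable borel" and g0: "\<And>y. g y \<ge> 0"
    and ab: "a \<ge> 0" "b \<ge> 0"
    and q: "q = 1 / (2 * (p - 1))" and \<beta>: "\<beta> = (p - \<alpha>) / (2 * (p - 1))"
    and A_le: "\<And>t x. 0 < t \<Longrightarrow> t < T \<Longrightarrow> x $ k = 0 \<Longrightarrow>
      weighted_measure.flow M (\<lambda>_. 1) k t x \<le> ennreal (a * T powr - q)"
    and C_le: "\<And>t x. 0 < t \<Longrightarrow> t < T \<Longrightarrow>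
      weighted_measure.flow lborel (\<lambda>y. ennreal (g y powr \<alpha>)) k t x \<le> ennreal ((b * t powr - q) powr \<alpha>)"
    and small1: "4 powr p * (4 * Beta (1 / 2) (1 / 2)) * a powr (p - 1) \<le> 1"
    and small2: "4 powr p * (4 * Beta (1 / 2 - \<beta>) (1 / 2)) * b powr (p - 1) \<le> 2 - 2 powr (1 - 1 / \<alpha>)"
  shows "\<exists>u. is_solution k p T
      (\<lambda>t x. weighted_measure.flow M (\<lambda>_. 1) k t x + weighted_measure.flow lborel (\<lambda>y. ennreal (g y)) k t x) u \<and>
    (\<forall>x\<in>halfspace_closed k. \<forall>t\<in>{0<..<T}. 0 \<le> u x t \<and>
      ennreal (u x t) \<le> 2 * weighted_measure.flow M (\<lambda>_. 1) k t x
        + 2 * enn_root \<alpha> (weighted_measure.flow lborel (\<lambda>y. ennreal (g y powr \<alpha>)) k t x))"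
proof -
  interpret A: weighted_measure M "\<lambda>_. 1" by (rule W)
  interpret B: weighted_measure lborel "\<lambda>y. ennreal (g y)" by unfold_locales auto
  interpret C: weighted_measure lborel "\<lambda>y. ennreal (g y powr \<alpha>)" by unfold_locales auto
  interpret L: weighted_measure "lborel :: (real^'n) measure" "\<lambda>_. 1" by unfold_locales auto
  have \<beta>_less: "\<beta> < 1 / 2" and q_pos: "q > 0"
    using p \<alpha> by (auto simp: \<beta> q divide_less_eq)
  \<comment> \<open>Parabolic scaling: with these identities the powers of time cancel below, so the
    smallness conditions do not involve \<open>T\<close>.\<close>
  have q1: "q * (p - 1) = 1 / 2" and q\<alpha>: "q * (p - \<alpha>) = \<beta>" "q * (\<alpha> - 1) = 1 / 2 - \<beta>"
    using p by (auto simp: q \<beta> field_simps)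
  define A where "A t x = enn2real (A.flow k t x)" for t x
  define J where "J t x = enn2real (C.flow k t x)" for t x
  define v where "v t x = J t x powr (1 / \<alpha>)" for t x
  have A0: "A t x \<ge> 0" and J0: "J t x \<ge> 0" and v0: "v t x \<ge> 0" for t x
    by (auto simp: A_def J_def v_def)
  \<comment> \<open>The bound \<open>A_le\<close> concerns boundary points only, but the origin is
    one of them.\<close>
  have A_fin: "A.flow k t x < \<infinity>" if "0 < t" "t < T" for t x
    using that
    by (intro A.flow_finite[where T = T and t = t]) (auto intro: le_less_trans[OF A_le ennreal_less_top])
  have A_eq: "A.flow k t x = ennreal (A t x)" if "0 < t" "t < T" for t x
    using A_fin[OF that] by (simp add: A_def)
  have J_eq: "C.flow k t x = ennreal (J t x)" if "0 < t" "t < T" for t x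
    using le_less_trans[OF C_le[OF that] ennreal_less_top] by (simp add: J_def)
  have J_v: "J t x = v t x powr \<alpha>" for t x
    using \<alpha> J0 by (simp add: v_def powr_powr)
  have A_bd: "A s y \<le> a * T powr - q" if "0 < s" "s < T" "y $ k = 0" for s y
    using A_le[OF that] ab unfolding A_eq[OF that(1,2)] by (subst (asm) ennreal_le_iff) auto
  have v_bd: "v t x \<le> b * t powr - q" if "0 < t" "t < T" for t x
  proof -
    have "J t x \<le> (b * t powr - q) powr \<alpha>"
      using C_le[OF that, of x] unfolding J_eq[OF that] by (subst (asm) ennreal_le_iff) auto
    then have "v t x \<le> ((b * t powr - q) powr \<alpha>) powr (1 / \<alpha>)"
      unfolding v_def using \<alpha> J0 by (intro powr_mono2) auto
    then show ?thesis using \<alpha> ab by (simp add: powr_powr)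
  qed
  \<comment> \<open>Hoelder's constant for a kernel of mass at most 2, one unit for each of the two
    Gaussians. It lies below 2 because the exponent \<open>1 - 1/\<alpha>\<close> is less than
    1.\<close>
  define \<kappa> where "\<kappa> = 2 powr (1 - 1 / \<alpha>)"
  have B_le: "B.flow k t x \<le> ennreal (\<kappa> * v t x)" if "0 < t" "t < T" for t x
  proof -
    have "L.flow k t x \<le> 2 * 1"
      by (rule L.flow_le_two_heat) (use that in \<open>simp add: nn_integral_heat_kernel\<close>)
    then show ?thesis
      unfolding B.flow_def \<kappa>_def v_def
      by (intro nn_integral_le_powr_integral \<alpha> g0)
         (use J_eq[OF that] J0 in \<open>auto simp: L.flow_def C.flow_def\<close>)
  qed
  define w where "w t x = ennreal (2 * A t x + 2 * v t x)" for t x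
  have w_real: "enn2real (w t x) = 2 * A t x + 2 * v t x" for t x
    using A0[of t x] v0[of t x] by (simp add: w_def del: ennreal_plus)
  define P where "P f s y = ennreal (enn2real (f s y) powr p)" for f and s :: real and y :: "real^'n"
  \<comment> \<open>One power of \<open>A\<close> and the power \<alpha> of \<open>v\<close> are
    kept, since these are genuine flows; the surplus powers are spent on the decay bounds. The
    factor \<open>s powr - 0\<close> puts the first term in the form treated by
    \<open>duhamel_flow_le\<close>.\<close>
  have Pw: "P w s y \<le> ennreal (4 powr p * a powr (p - 1) * T powr - (1 / 2)) * (ennreal (s powr - 0) * A.flow k s y)
      + ennreal (4 powr p * b powr (p - \<alpha>)) * (ennreal (s powr - \<beta>) * C.flow k s y)"
    if s: "0 < s" "s < T" and y: "y $ k = 0" for s y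
  proof -
    have Ap: "A s y powr p \<le> a powr (p - 1) * T powr - (1 / 2) * A s y"
    proof -
      have "A s y powr p = A s y powr (p - 1) * A s y"
        using A0 powr_add[of "A s y" "p - 1" 1] by simp
      also have "\<dots> \<le> (a * T powr - q) powr (p - 1) * A s y"
        using A0 A_bd[OF s y] p by (intro mult_right_mono powr_mono2) auto
      also have "(a * T powr - q) powr (p - 1) = a powr (p - 1) * T powr - (1 / 2)"
        by (simp only: powr_mult powr_powr mult_minus_left q1)
      finally show ?thesis .
    qed
    have vp: "v s y powr p \<le> b powr (p - \<alpha>) * s powr - \<beta> * J s y"
    proof -
      have "v s y powr p = v s y powr (p - \<alpha>) * J s y"
        unfolding J_v by (simp add: powr_add[symmetric])
      also have "\<dots> \<le> (b * s powr - q) powr (p - \<alpha>) * J s y"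
        using v0 v_bd[OF s] J0 \<alpha> by (intro mult_right_mono powr_mono2) auto
      also have "(b * s powr - q) powr (p - \<alpha>) = b powr (p - \<alpha>) * s powr - \<beta>"
        by (simp only: powr_mult powr_powr mult_minus_left q\<alpha>)
      finally show ?thesis .
    qed
    have "(2 * A s y + 2 * v s y) powr p \<le> 4 powr p * (A s y powr p + v s y powr p)"
      using A0 v0 p by (intro powr_double_add_le) auto
    also have "\<dots> \<le> 4 powr p * (a powr (p - 1) * T powr - (1 / 2) * A s y + b powr (p - \<alpha>) * s powr - \<beta> * J s y)"
      using Ap vp by (intro mult_left_mono add_mono) auto
    finally have "P w s y \<le> ennreal (4 powr p * a powr (p - 1) * T powr - (1 / 2) * A s y
        + 4 powr p * b powr (p - \<alpha>) * (s powr - \<beta> * J s y))"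
      unfolding P_def w_real by (intro ennreal_leI) (simp add: distrib_left mult.assoc)
    also have "\<dots> = ennreal (4 powr p * a powr (p - 1) * T powr - (1 / 2)) * ennreal (A s y)
        + ennreal (4 powr p * b powr (p - \<alpha>)) * (ennreal (s powr - \<beta>) * ennreal (J s y))"
      using A0 J0 ab by (simp only: ennreal_plus ennreal_mult mult_nonneg_nonneg powr_ge_zero)
    finally show ?thesis
      using s by (simp add: A_eq[OF s] J_eq[OF s])
  qed
  have duh: "duhamel k (P w) t x \<le> ennreal (A t x) + ennreal ((2 - \<kappa>) * v t x)" if t: "0 < t" "t < T" for t x
  proof -
    let ?k1 = "4 powr p * a powr (p - 1) * T powr - (1 / 2)" and ?k2 = "4 powr p * b powr (p - \<alpha>)"
    let ?B0 = "4 * Beta (1 / 2) (1 / 2) :: real" and ?B1 = "4 * Beta (1 / 2 - \<beta>) (1 / 2)"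
    have B0: "?B0 \<ge> 0" "?B1 \<ge> 0" using \<beta>_less by (auto simp: Beta_def Gamma_real_nonneg less_imp_le)
    have "duhamel k (P w) t x \<le> duhamel k (\<lambda>s y. ennreal ?k1 * (ennreal (s powr - 0) * A.flow k s y)
      + ennreal ?k2 * (ennreal (s powr - \<beta>) * C.flow k s y)) t x"
      using t by (intro duhamel_mono Pw) auto
    also have "\<dots> = ennreal ?k1 * duhamel k (\<lambda>s y. ennreal (s powr - 0) * A.flow k s y) t x
      + ennreal ?k2 * duhamel k (\<lambda>s y. ennreal (s powr - \<beta>) * C.flow k s y) t x"
      by (subst duhamel_add, simp add: split_beta', simp add: split_beta',
          subst duhamel_cmult, simp add: split_beta', subst duhamel_cmult, simp add: split_beta', rule refl)
    also have "\<dots> \<le> ennreal ?k1 * (ennreal (4 * Beta (1 / 2 - 0) (1 / 2) * t powr (1 / 2 - 0)) * A.flow k t x)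
      + ennreal ?k2 * (ennreal (?B1 * t powr (1 / 2 - \<beta>)) * C.flow k t x)"
      using t \<beta>_less by (intro add_mono mult_left_mono A.duhamel_flow_le C.duhamel_flow_le) auto
    also have "\<dots> = ennreal (?k1 * (?B0 * t powr (1 / 2)) * A t x) + ennreal (?k2 * (?B1 * t powr (1 / 2 - \<beta>)) * J t x)"
      using A0 J0 B0 unfolding A_eq[OF t] J_eq[OF t] diff_zero
      by (simp only: ennreal_mult mult_nonneg_nonneg powr_ge_zero mult.assoc)
    also have "\<dots> \<le> ennreal (A t x) + ennreal ((2 - \<kappa>) * v t x)"
    proof (intro add_mono ennreal_leI)
      have "t powr (1 / 2) \<le> T powr (1 / 2)" using t by (intro powr_mono2) auto
      then have "?k1 * (?B0 * t powr (1 / 2)) \<le> ?k1 * (?B0 * T powr (1 / 2))"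
        using B0 by (intro mult_left_mono) auto
      also have "\<dots> = 4 powr p * ?B0 * a powr (p - 1) * (T powr - (1 / 2) * T powr (1 / 2))"
        by (simp only: mult_ac)
      also have "T powr - (1 / 2) * T powr (1 / 2) = 1"
        using t by (simp add: powr_add[symmetric])
      also have "4 powr p * ?B0 * a powr (p - 1) * 1 \<le> 1" using small1 by simp
      finally show "?k1 * (?B0 * t powr (1 / 2)) * A t x \<le> A t x"
        using mult_right_mono[OF _ A0, of _ 1 t x] by simp
    next
      \<comment> \<open>Spending \<open>v powr (\<alpha> - 1)\<close> on its decay bound cancels
        exactly the gain \<open>t powr (1/2 - \<beta>)\<close> and completes
        \<open>b powr (p - \<alpha>)\<close> to \<open>b powr (p - 1)\<close>.\<close>
      have "J t x = v t x powr (\<alpha> - 1) * v t x"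
        unfolding J_v using v0[of t x] powr_add[of "v t x" "\<alpha> - 1" 1] by simp
      also have "\<dots> \<le> (b * t powr - q) powr (\<alpha> - 1) * v t x"
        using v0 v_bd[OF t] \<alpha> by (intro mult_right_mono powr_mono2) auto
      also have "(b * t powr - q) powr (\<alpha> - 1) = b powr (\<alpha> - 1) * t powr - (1 / 2 - \<beta>)"
        by (simp only: powr_mult powr_powr mult_minus_left q\<alpha>)
      finally have "?k2 * (?B1 * t powr (1 / 2 - \<beta>)) * J t x
          \<le> ?k2 * (?B1 * t powr (1 / 2 - \<beta>)) * (b powr (\<alpha> - 1) * t powr - (1 / 2 - \<beta>) * v t x)"
        using B0 by (intro mult_left_mono mult_nonneg_nonneg) auto
      also have "\<dots> = 4 powr p * ?B1 * (b powr (p - \<alpha>) * b powr (\<alpha> - 1))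
          * (t powr (1 / 2 - \<beta>) * t powr - (1 / 2 - \<beta>)) * v t x"
        by (simp only: mult_ac)
      also have "t powr (1 / 2 - \<beta>) * t powr - (1 / 2 - \<beta>) = 1"
        using t by (simp only: powr_add[symmetric]) simp
      also have "b powr (p - \<alpha>) * b powr (\<alpha> - 1) = b powr (p - 1)"
        by (simp add: powr_add[symmetric])
      also have "4 powr p * ?B1 * b powr (p - 1) * 1 * v t x \<le> (2 - \<kappa>) * v t x"
        using small2 v0 unfolding \<kappa>_def by (intro mult_right_mono) auto
      finally show "?k2 * (?B1 * t powr (1 / 2 - \<beta>)) * J t x \<le> (2 - \<kappa>) * v t x" .
    qed
    finally show ?thesis .
  qed
  have \<kappa>2: "\<kappa> \<ge> 0" "\<kappa> \<le> 2"
    using \<alpha> powr_mono[of "1 - 1 / \<alpha>" 1 "2::real"] by (auto simp: \<kappa>_def)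
  define S0 where "S0 t x = A.flow k t x + B.flow k t x" for t x
  have S0m: "case_prod S0 \<in> borel_measurable (borel \<Otimes>\<^sub>M borel)"
    unfolding S0_def split_beta' by measurable
  have super: "S0 t x + duhamel k (P w) t x \<le> w t x" if t: "0 < t" "t < T" for t x
  proof -
    have "S0 t x + duhamel k (P w) t x
        \<le> (ennreal (A t x) + ennreal (\<kappa> * v t x)) + (ennreal (A t x) + ennreal ((2 - \<kappa>) * v t x))"
      unfolding S0_def A_eq[OF t] by (intro add_mono order_refl B_le duh t)
    also have "\<dots> = ennreal ((A t x + \<kappa> * v t x) + (A t x + (2 - \<kappa>) * v t x))"
      using A0 v0 \<kappa>2 by (simp only: ennreal_plus mult_nonneg_nonneg add_nonneg_nonneg diff_ge_0_iff_ge)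
    also have "\<dots> = w t x" by (simp add: w_def algebra_simps)
    finally show ?thesis .
  qed
  obtain u where um[measurable]: "case_prod u \<in> borel_measurable (borel \<Otimes>\<^sub>M borel)"
    and uw: "\<And>t x. 0 < t \<Longrightarrow> t < T \<Longrightarrow> u t x \<le> w t x"
    and u_eq: "\<And>t x. 0 < t \<Longrightarrow> t < T \<Longrightarrow>
      u t x = S0 t x + duhamel k (\<lambda>s y. ennreal (enn2real (u s y) powr p)) t x"
    using supersolution_imp_solution[OF _ S0m, of p T k w] super p unfolding P_def
    by (auto simp: w_def)
  define f where "f s y = enn2real (u s y) powr p" for s y
  have fm: "case_prod f \<in> borel_measurable (borel \<Otimes>\<^sub>M borel)"
    unfolding f_def split_beta' by measurable
  have u_fin: "u t x < \<infinity>" if "0 < t" "t < T" for t x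
    using le_less_trans[OF uw[OF that], of x \<infinity>] by (simp add: w_def)
  have u_eq': "u t x = S0 t x + duhamel k (\<lambda>s y. ennreal (f s y)) t x" if "0 < t" "t < T" for t x
    unfolding f_def by (rule u_eq[OF that])
  have D_fin: "duhamel k (\<lambda>s y. ennreal (f s y)) t x < \<infinity>" if "0 < t" "t < T" for t x
    using u_fin[OF that, of x] unfolding u_eq'[OF that] by auto
  have B_fin: "B.flow k t x < \<infinity>" if "0 < t" "t < T" for t x
    using le_less_trans[OF B_le[OF that] ennreal_less_top, of x] by simp
  \<comment> \<open>The bound on \<open>v\<close> blows up as time tends to 0 and the one on
    \<open>A\<close> holds on the boundary only; \<open>continuous_on_duhamel\<close> asks for no
    more than this.\<close>
  have bdd: "\<exists>K. \<forall>s y. c \<le> s \<longrightarrow> s < T \<longrightarrow> y $ k = 0 \<longrightarrow> f s y \<le> K" if c: "0 < c" for c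
  proof (intro exI allI impI)
    fix s and y :: "real^'n" assume s: "c \<le> s" "s < T" "y $ k = 0"
    then have s': "0 < s" "s < T" using c by auto
    have "v s y \<le> b * c powr - q"
      using v_bd[OF s', of y] powr_mono2'[of "- q" c s] q_pos c s ab
      by (auto intro: order_trans mult_left_mono)
    then have "2 * A s y + 2 * v s y \<le> 2 * (a * T powr - q) + 2 * (b * c powr - q)"
      using A_bd[OF s' s(3)] by simp
    moreover have "enn2real (u s y) \<le> enn2real (w s y)"
      using uw[OF s', of y] by (intro enn2real_mono) (auto simp: w_def)
    ultimately have "enn2real (u s y) \<le> 2 * (a * T powr - q) + 2 * (b * c powr - q)"
      by (simp add: w_real)
    then show "f s y \<le> (2 * (a * T powr - q) + 2 * (b * c powr - q)) powr p"
      unfolding f_def using p by (intro powr_mono2) auto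
  qed
  \<comment> \<open>A monotone limit need not be continuous, so continuity is read off the integral
    equation: each of its three terms is finite and continuous, and finiteness makes
    \<open>enn2real\<close> additive on them.\<close>
  have "continuous_on (UNIV \<times> {0<..<T}) (\<lambda>z. (case z of (x, t) \<Rightarrow> enn2real (A.flow k t x))
      + (case z of (x, t) \<Rightarrow> enn2real (B.flow k t x))
      + (case z of (x, t) \<Rightarrow> enn2real (duhamel k (\<lambda>s y. ennreal (f s y)) t x)))"
    by (intro continuous_on_add A.continuous_on_flow B.continuous_on_flow continuous_on_duhamel fm D_fin bdd)
       (use A_fin B_fin in \<open>auto simp: f_def\<close>)
  also have "?this \<longleftrightarrow> continuous_on (UNIV \<times> {0<..<T}) (\<lambda>(x, t). enn2real (u t x))"
  proof (rule continuous_on_cong)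
    fix z assume "z \<in> (UNIV :: (real^'n) set) \<times> {0<..<T}"
    then obtain x t where z: "z = (x, t)" and t: "0 < t" "t < T" by auto
    show "(case z of (x, t) \<Rightarrow> enn2real (A.flow k t x)) + (case z of (x, t) \<Rightarrow> enn2real (B.flow k t x))
      + (case z of (x, t) \<Rightarrow> enn2real (duhamel k (\<lambda>s y. ennreal (f s y)) t x)) = (case z of (x, t) \<Rightarrow> enn2real (u t x))"
      using A_fin[OF t, of x] B_fin[OF t, of x] D_fin[OF t, of x]
      by (simp add: z u_eq'[OF t] S0_def enn2real_plus)
  qed simp
  finally have cont: "continuous_on (halfspace_closed k \<times> {0<..<T}) (\<lambda>(x, t). enn2real (u t x))"
    by (rule continuous_on_subset) auto
  show ?thesis
  proof (intro exI[of _ "\<lambda>x t. enn2real (u t x)"] conjI ballI)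
    show "is_solution k p T (\<lambda>t x. A.flow k t x + B.flow k t x) (\<lambda>x t. enn2real (u t x))"
      unfolding is_solution_def
    proof (intro conjI ballI)
      fix x :: "real^'n" and t assume "t \<in> {0<..<T}"
      then have t: "0 < t" "t < T" by auto
      have "ennreal (enn2real (u t x)) = u t x" using u_fin[OF t] by simp
      also have "\<dots> = A.flow k t x + B.flow k t x + (\<integral>\<^sup>+ s. indicator {0<..<t} s *
         (\<integral>\<^sup>+ y. ennreal (Gker k x y (t - s) * (enn2real (u s y)) powr p) \<partial>bdry_measure k) \<partial>lborel)"
        unfolding u_eq'[OF t] S0_def duhamel_def f_def by (simp add: ennreal_mult)
      finally show "ennreal (enn2real (u t x)) = A.flow k t x + B.flow k t x
         + (\<integral>\<^sup>+ s. indicator {0<..<t} s *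
         (\<integral>\<^sup>+ y. ennreal (Gker k x y (t - s) * (enn2real (u s y)) powr p) \<partial>bdry_measure k) \<partial>lborel)" .
    qed (use cont in auto)
  next
    fix x :: "real^'n" and t assume "t \<in> {0<..<T}"
    then have t: "0 < t" "t < T" by auto
    have "ennreal (enn2real (u t x)) \<le> w t x" using u_fin[OF t] uw[OF t] by simp
    also have "w t x = 2 * A.flow k t x + 2 * enn_root \<alpha> (C.flow k t x)"
      using A0 v0 J0 by (simp add: w_def A_eq[OF t] J_eq[OF t] enn_root_ennreal v_def ennreal_mult)
    finally show "ennreal (enn2real (u t x)) \<le> 2 * A.flow k t x + 2 * enn_root \<alpha> (C.flow k t x)" .
  qed simp
qed

section \<open>Choice of the smallness constant and reduction to Borel data\<close>

lemma le_if_enn_root_le: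
  assumes "a > 0" "c \<ge> 0" "enn_root a z \<le> ennreal c"
  shows "z \<le> ennreal (c powr a)"
proof (cases z)
  case (real r)
  then have "r powr (1 / a) \<le> c" using assms by (simp add: enn_root_ennreal)
  then have "(r powr (1 / a)) powr a \<le> c powr a" using assms by (intro powr_mono2) auto
  then show ?thesis using assms real by (simp add: powr_powr ennreal_leI)
next
  case top
  then show ?thesis using assms(3) by (simp add: enn_root_def top_unique)
qed

lemma exists_small_powr:
  fixes K e r :: real
  assumes "K \<ge> 0" "e > 0" "r > 0"
  shows "\<exists>\<gamma>0 > 0. \<forall>\<gamma>. 0 \<le> \<gamma> \<and> \<gamma> \<le> \<gamma>0 \<longrightarrow> K * \<gamma> powr r \<le> e"
\<comment> \<open>\<open>K + 1\<close> instead of \<open>K\<close> keeps the witness meaningful for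
  \<open>K = 0\<close>.\<close>
proof (intro exI[of _ "(e / (K + 1)) powr (1 / r)"] conjI allI impI)
  fix \<gamma> assume "0 \<le> \<gamma> \<and> \<gamma> \<le> (e / (K + 1)) powr (1 / r)"
  then have "\<gamma> powr r \<le> ((e / (K + 1)) powr (1 / r)) powr r"
    using assms by (intro powr_mono2) auto
  also have "\<dots> = e / (K + 1)" using assms by (simp add: powr_powr)
  finally have "K * \<gamma> powr r \<le> K * (e / (K + 1))" using assms by (intro mult_left_mono) auto
  also have "\<dots> \<le> e" using assms by (simp add: field_simps)
  finally show "K * \<gamma> powr r \<le> e" .
qed (use assms in simp)

text \<open>The second datum is merely Lebesgue measurable, while the flows are built over Borel
  sets; an almost everywhere equal Borel representative yields the same integrals.\<close>

lemma Sop_fmeas: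
  fixes \<phi> g :: "real^'n \<Rightarrow> real"
  assumes [measurable]: "\<phi> \<in> borel_measurable lebesgue" "g \<in> borel_measurable borel"
    and ae: "AE y in lborel. \<phi> y = g y"
  shows "Sop k t (fmeas \<phi>) x = weighted_measure.flow lborel (\<lambda>y. ennreal (g y)) k t x"
proof -
  interpret W: weighted_measure lborel "\<lambda>y. ennreal (g y)" by unfold_locales auto
  have [measurable]: "(\<lambda>y. ennreal (Gker k x y t) * indicator (halfspace_closed k) y) \<in> borel_measurable lebesgue"
    by (rule measurable_completion) measurable
  have "Sop k t (fmeas \<phi>) x
      = (\<integral>\<^sup>+ y. ennreal (\<phi> y) * (ennreal (Gker k x y t) * indicator (halfspace_closed k) y) \<partial>lborel)"
    unfolding Sop_def fmeas_def by (subst nn_integral_density) (auto simp: nn_integral_completion)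
  also have "\<dots> = W.flow k t x"
    unfolding W.flow_def using ae
    by (intro nn_integral_cong_AE) (auto elim!: eventually_mono simp: mult_ac)
  finally show ?thesis .
qed

lemma sigma_finite_if_finite_on_compact:
  fixes M :: "'a::euclidean_space measure"
  assumes "sets M = sets borel" "\<And>K. compact K \<Longrightarrow> emeasure M K < \<infinity>"
  shows "sigma_finite_measure M"
proof
  have "space M = UNIV" using sets_eq_imp_space_eq[OF assms(1)] by simp
  moreover have "(\<Union>n. cball (0::'a) (real n)) = UNIV"
    by (auto simp: real_arch_simple)
  ultimately show "\<exists>A. countable A \<and> A \<subseteq> sets M \<and> \<Union>A = space M \<and> (\<forall>a\<in>A. emeasure M a \<noteq> \<infinity>)"
    using assms by (intro exI[of _ "range (\<lambda>n. cball 0 (real n))"]) (auto simp: less_top[symmetric])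
qed

theorem theorem1p4:
  fixes p \<alpha> \<delta> :: real
  assumes "p > 1" and "1 < \<alpha>" and "\<alpha> < p" and "0 < \<delta>" and "\<delta> < 1"
  shows "\<exists>\<gamma>3 > 0. \<forall>(k::'n::finite) T (\<mu>1 :: (real^'n) measure) (\<mu>2 :: real^'n \<Rightarrow> real).
     T > 0 \<longrightarrow>
     sets \<mu>1 = sets borel \<longrightarrow>
     (\<forall>K. compact K \<longrightarrow> emeasure \<mu>1 K < \<infinity>) \<longrightarrow>
     emeasure \<mu>1 (UNIV - D_L k T) = 0 \<longrightarrow>
     (\<forall>x\<in>D_L k T.
        (\<integral>\<^sup>+ y. ennreal (exp (- ((1 - \<delta>) / (4 * T)) * (y $ k)\<^sup>2)) * indicator (ball x (sqrt T)) y \<partial>\<mu>1)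
          / emeasure lebesgue (ball x (sqrt T))
        \<le> ennreal (\<gamma>3 * T powr (- 1 / (2 * (p - 1))))) \<longrightarrow>
     \<mu>2 \<in> borel_measurable lebesgue \<longrightarrow>
     (\<forall>y. \<mu>2 y \<ge> 0) \<longrightarrow>
     (AE y in lebesgue. y \<notin> D_L' k T \<longrightarrow> \<mu>2 y = 0) \<longrightarrow>
     (\<forall>x\<in>D_L' k T. \<forall>\<sigma>. 0 < \<sigma> \<and> \<sigma> < sqrt T \<longrightarrow>
        enn_root \<alpha> ((\<integral>\<^sup>+ y. ennreal (\<mu>2 y powr \<alpha>) * indicator (ball x \<sigma>) y \<partial>lebesgue)
                        / emeasure lebesgue (ball x \<sigma>))
        \<le> ennreal (\<gamma>3 * \<sigma> powr (- 1 / (p - 1)))) \<longrightarrow>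
     (\<exists>u. is_solution k p T (\<lambda>t x. Sop k t \<mu>1 x + Sop k t (fmeas \<mu>2) x) u \<and>
          (\<forall>x\<in>halfspace_closed k. \<forall>t\<in>{0<..<T}.
             0 \<le> u x t \<and>
             ennreal (u x t) \<le> 2 * Sop k t \<mu>1 x + 2 * enn_root \<alpha> (Sop k t (fmeas (\<lambda>y. \<mu>2 y powr \<alpha>)) x)))"
proof -
  define q where "q = 1 / (2 * (p - 1))"
  define \<beta> where "\<beta> = (p - \<alpha>) / (2 * (p - 1))"
  \<comment> \<open>\<open>C1\<close> and \<open>C2\<close> are the decay constants of the two
    flows; in \<open>C2\<close> the 2 counts the two Gaussians, and \<open>exp (1/16)\<close> is the
    averaging cost at radius \<open>sqrt t\<close> and time \<open>t\<close>. The latter bounds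
    \<open>v powr \<alpha>\<close>, so its root appears in \<open>K2\<close>. \<open>K1\<close> and
    \<open>K2\<close> are the coefficients of the two smallness conditions for
    \<open>a = C1 * \<gamma>\<close> and \<open>b = C2 powr (1/\<alpha>) * \<gamma>\<close>.\<close>
  define C1 where "C1 = decay_const \<delta> CARD('n)"
  define C2 where "C2 = 2 * (exp (1 / 16) * 2 powr (3 * real CARD('n) / 2))"
  define K1 where "K1 = 4 powr p * (4 * Beta (1 / 2) (1 / 2)) * C1 powr (p - 1)"
  define K2 where "K2 = 4 powr p * (4 * Beta (1 / 2 - \<beta>) (1 / 2)) * (C2 powr (1 / \<alpha>)) powr (p - 1)"
  have \<beta>_less: "\<beta> < 1 / 2" using assms by (auto simp: \<beta>_def divide_less_eq)
  have C: "C1 \<ge> 0" "C2 \<ge> 0" using assms by (auto simp: C1_def C2_def decay_const_def)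
  have K: "K1 \<ge> 0" "K2 \<ge> 0"
    using \<beta>_less by (auto simp: K1_def K2_def Beta_def Gamma_real_nonneg less_imp_le)
  have e: "2 - 2 powr (1 - 1 / \<alpha>) > (0::real)"
    using assms powr_less_mono[of "1 - 1 / \<alpha>" 1 "2::real"] by simp
  obtain \<gamma>1 where \<gamma>1: "\<gamma>1 > 0" "\<And>\<gamma>. 0 \<le> \<gamma> \<Longrightarrow> \<gamma> \<le> \<gamma>1 \<Longrightarrow> K1 * \<gamma> powr (p - 1) \<le> 1"
    using exists_small_powr[OF K(1), of 1 "p - 1"] assms by auto
  obtain \<gamma>2 where \<gamma>2: "\<gamma>2 > 0" "\<And>\<gamma>. 0 \<le> \<gamma> \<Longrightarrow> \<gamma> \<le> \<gamma>2 \<Longrightarrow> K2 * \<gamma> powr (p - 1) \<le> 2 - 2 powr (1 - 1 / \<alpha>)"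
    using exists_small_powr[OF K(2) e, of "p - 1"] assms by auto
  define \<gamma> where "\<gamma> = min \<gamma>1 \<gamma>2"
  have \<gamma>: "\<gamma> > 0" using \<gamma>1 \<gamma>2 by (simp add: \<gamma>_def)
  show ?thesis
  proof (intro exI[of _ \<gamma>] conjI \<gamma> allI impI)
    fix k :: 'n and T and \<mu>1 :: "(real^'n) measure" and \<mu>2 :: "real^'n \<Rightarrow> real"
    assume T: "T > 0"
      and sets1: "sets \<mu>1 = sets borel"
      and radon: "\<forall>K. compact K \<longrightarrow> emeasure \<mu>1 K < \<infinity>"
      and supp1: "emeasure \<mu>1 (UNIV - D_L k T) = 0"
      and avg1: "\<forall>x\<in>D_L k T.
        (\<integral>\<^sup>+ y. ennreal (exp (- ((1 - \<delta>) / (4 * T)) * (y $ k)\<^sup>2)) * indicator (ball x (sqrt T)) y \<partial>\<mu>1)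
          / emeasure lebesgue (ball x (sqrt T)) \<le> ennreal (\<gamma> * T powr (- 1 / (2 * (p - 1))))"
      and meas2[measurable]: "\<mu>2 \<in> borel_measurable lebesgue"
      and nonneg2: "\<forall>y. \<mu>2 y \<ge> 0"
      and supp2: "AE y in lebesgue. y \<notin> D_L' k T \<longrightarrow> \<mu>2 y = 0"
      and avg2: "\<forall>x\<in>D_L' k T. \<forall>\<sigma>. 0 < \<sigma> \<and> \<sigma> < sqrt T \<longrightarrow>
        enn_root \<alpha> ((\<integral>\<^sup>+ y. ennreal (\<mu>2 y powr \<alpha>) * indicator (ball x \<sigma>) y \<partial>lebesgue)
                        / emeasure lebesgue (ball x \<sigma>)) \<le> ennreal (\<gamma> * \<sigma> powr (- 1 / (p - 1)))"
    have W: "weighted_measure \<mu>1 (\<lambda>_. 1)"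
      using sigma_finite_if_finite_on_compact[OF sets1] radon sets1
      by (auto simp: weighted_measure_def weighted_measure_axioms_def)
    obtain g' where g'[measurable]: "g' \<in> borel_measurable lborel" and ae': "AE y in lborel. \<mu>2 y = g' y"
      using completion_ex_borel_measurable_real[OF meas2] by blast
    \<comment> \<open>The Borel representative may be negative on a null set; truncation restores
      the sign everywhere without affecting the almost everywhere equality.\<close>
    define g where "g y = max 0 (g' y)" for y
    have g[measurable]: "g \<in> borel_measurable borel" and g0: "g y \<ge> 0" for y
      unfolding g_def using g' by auto
    have ae: "AE y in lborel. \<mu>2 y = g y"
      using ae' by eventually_elim (use nonneg2 in \<open>metis g_def max_absorb2\<close>)
    interpret A: weighted_measure \<mu>1 "\<lambda>_. 1" by (rule W)
    interpret C: weighted_measure lborel "\<lambda>y. ennreal (g y powr \<alpha>)" by unfold_locales auto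
    have Sop1: "Sop k t \<mu>1 x = A.flow k t x" for t x
      by (simp add: Sop_def A.flow_def)
    have Sop2: "Sop k t (fmeas \<mu>2) x = weighted_measure.flow lborel (\<lambda>y. ennreal (g y)) k t x" for t x
      by (rule Sop_fmeas) (use ae in auto)
    have Sop3: "Sop k t (fmeas (\<lambda>y. \<mu>2 y powr \<alpha>)) x = C.flow k t x" for t x
      by (rule Sop_fmeas) (use ae in auto)
    have D1: "AE y in \<mu>1. y \<in> D_L k T"
    proof (rule AE_I)
      show "UNIV - D_L k T \<in> sets \<mu>1" unfolding sets1 D_L_def by measurable
    qed (use supp1 in auto)
    have A_le: "A.flow k t x \<le> ennreal (C1 * \<gamma> * T powr - q)" if "0 < t" "t < T" "x $ k = 0" for t x
    proof -
      have "A.flow k t x \<le> ennreal C1 * ennreal (\<gamma> * T powr - q)"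
        unfolding C1_def
        by (rule flow_boundary_le_weighted_average[OF W that(1,2) assms(4,5) D1 _ that(3)])
           (use avg1 in \<open>simp add: q_def\<close>)
      then show ?thesis using C \<gamma> by (simp add: ennreal_mult[symmetric] mult.assoc)
    qed
    have C_le: "C.flow k t x \<le> ennreal ((C2 powr (1 / \<alpha>) * \<gamma> * t powr - q) powr \<alpha>)" if t: "0 < t" "t < T" for t x
    proof -
      have s: "sqrt t > 0" "sqrt t < sqrt T" using t by auto
      have st: "sqrt t powr (- 1 / (p - 1)) = t powr - q"
        using t by (simp add: powr_half_sqrt[symmetric] powr_powr q_def)
      have avg: "(\<integral>\<^sup>+ y. ennreal (g y powr \<alpha>) * indicator (ball z (sqrt t)) y \<partial>lborel) / emeasure lebesgue (ball z (sqrt t))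
          \<le> ennreal ((\<gamma> * t powr - q) powr \<alpha>)" if z: "z \<in> D_L' k T" for z
      proof (rule le_if_enn_root_le)
        have eq: "(\<integral>\<^sup>+ y. ennreal (\<mu>2 y powr \<alpha>) * indicator (ball z (sqrt t)) y \<partial>lebesgue)
           = (\<integral>\<^sup>+ y. ennreal (g y powr \<alpha>) * indicator (ball z (sqrt t)) y \<partial>lborel)"
          unfolding nn_integral_completion
          by (rule nn_integral_cong_AE) (use ae in \<open>eventually_elim, simp\<close>)
        show "enn_root \<alpha> ((\<integral>\<^sup>+ y. ennreal (g y powr \<alpha>) * indicator (ball z (sqrt t)) y \<partial>lborel)
            / emeasure lebesgue (ball z (sqrt t))) \<le> ennreal (\<gamma> * t powr - q)"
          using bspec[OF avg2 z, rule_format, of "sqrt t"] s unfolding eq st by blast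
      qed (use assms \<gamma> in auto)
      have supp: "AE y in lborel. ennreal (g y powr \<alpha>) \<noteq> 0 \<longrightarrow> y \<in> D_L' k T"
        using ae supp2[unfolded AE_completion_iff] by eventually_elim (auto simp: g_def)
      have "C.flow k t x \<le> 2 * (ennreal (exp ((sqrt t)\<^sup>2 / (16 * t)) * 2 powr (3 * real CARD('n) / 2))
          * ennreal ((\<gamma> * t powr - q) powr \<alpha>))"
        by (rule C.flow_le_two_heat) (rule C.nn_integral_heat_kernel_le_average[OF s(1) t(1) supp avg])
      also have "(sqrt t)\<^sup>2 / (16 * t) = 1 / 16" using t by simp
      also have "2 * (ennreal (exp (1 / 16) * 2 powr (3 * real CARD('n) / 2)) * ennreal ((\<gamma> * t powr - q) powr \<alpha>))
          = ennreal (C2 * (\<gamma> * t powr - q) powr \<alpha>)"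
        unfolding C2_def by (simp add: ennreal_mult mult.assoc)
      also have "C2 * (\<gamma> * t powr - q) powr \<alpha> = (C2 powr (1 / \<alpha>) * \<gamma> * t powr - q) powr \<alpha>"
        using C assms by (simp add: powr_mult powr_powr mult.assoc)
      finally show ?thesis .
    qed
    have "4 powr p * (4 * Beta (1 / 2) (1 / 2)) * (C1 * \<gamma>) powr (p - 1) \<le> 1"
      using \<gamma>1(2)[of \<gamma>] \<gamma> by (simp add: K1_def \<gamma>_def powr_mult mult_ac)
    moreover have "4 powr p * (4 * Beta (1 / 2 - \<beta>) (1 / 2)) * (C2 powr (1 / \<alpha>) * \<gamma>) powr (p - 1) \<le> 2 - 2 powr (1 - 1 / \<alpha>)"
      using \<gamma>2(2)[of \<gamma>] \<gamma> unfolding K2_def powr_mult by (simp add: \<gamma>_def mult.assoc)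
    ultimately show "\<exists>u. is_solution k p T (\<lambda>t x. Sop k t \<mu>1 x + Sop k t (fmeas \<mu>2) x) u \<and>
          (\<forall>x\<in>halfspace_closed k. \<forall>t\<in>{0<..<T}. 0 \<le> u x t \<and>
             ennreal (u x t) \<le> 2 * Sop k t \<mu>1 x + 2 * enn_root \<alpha> (Sop k t (fmeas (\<lambda>y. \<mu>2 y powr \<alpha>)) x))"
      unfolding Sop1 Sop2 Sop3
      by (intro solution_exists_if_small[OF assms(1-3) W g g0 _ _ q_def \<beta>_def A_le C_le])
         (use C \<gamma> in auto)
  qed
qed

end
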